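(* Let $K=K(n)$ satisfy $K=\omega(\log n)$, and consider the Achlioptas process on $n$ vertices in which $K$ edges are presented at each round. Then the minimum number of rounds needed for Hamiltonicity is with high probability $n+o(n)$: there is an online algorithm which with high probability creates a Hamilton cycle within $n+o(n)$ rounds (and trivially no algorithm can do so in fewer than $n$ rounds).
   Context: The Achlioptas process with parameter $K$: start with the empty graph on $n$ labeled vertices. At each round, $K$ distinct edges are chosen uniformly at random among all pairs of vertices that are not edges of the current graph, and an online algorithm must add exactly one of them to the current graph (the others are discarded). The algorithm's choice may depend only on the history up to and including the current round. "With high probability" means with probability tending to $1$ as $n\to\infty$. *)

theory Defs
  imports "HOL-Probability.Probability" "HOL-Library.Landau_Symbols"
begin

type_synonym edge = "nat set"

definition all_edges :: "nat \<Rightarrow> edge set" where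
  "all_edges n = {e. e \<subseteq> {..<n} \<and> card e = 2}"

definition is_hamilton_cycle :: "nat \<Rightarrow> edge set \<Rightarrow> nat list \<Rightarrow> bool" where
  "is_hamilton_cycle n E vs \<longleftrightarrow>
     3 \<le> n \<and> length vs = n \<and> distinct vs \<and> set vs = {..<n} \<and>
     (\<forall>i<n. {vs ! i, vs ! (Suc i mod n)} \<in> E)"

definition hamiltonian :: "nat \<Rightarrow> edge set \<Rightarrow> bool" where
  "hamiltonian n E \<longleftrightarrow> (\<exists>vs. is_hamilton_cycle n E vs)"

text \<open>
  A history lists the rounds in chronological order; each round is recorded as the set of
  presented edges together with the edge that the algorithm selected.
\<close>

type_synonym history = "(edge set \<times> edge) list"

text \<open>
  The membership condition only matters in the degenerate rounds with an empty set of presented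
  edges, in which nothing is added to the graph.
\<close>

definition graph_of :: "history \<Rightarrow> edge set" where
  "graph_of h = {e. \<exists>S. (S, e) \<in> set h \<and> e \<in> S}"

type_synonym algorithm = "history \<Rightarrow> edge set \<Rightarrow> edge"

definition online_algorithm :: "algorithm \<Rightarrow> bool" where
  "online_algorithm A \<longleftrightarrow> (\<forall>h S. S \<noteq> {} \<longrightarrow> A h S \<in> S)"

text \<open>
  The possible sets presented in a round with current graph \<open>E\<close>.  The minimum makes the process
  total: if fewer than \<open>K\<close> non-edges are left, all of them are presented.
\<close>

definition offers :: "nat \<Rightarrow> nat \<Rightarrow> edge set \<Rightarrow> edge set set" where
  "offers n K E = {S. S \<subseteq> all_edges n - E \<and> card S = min K (card (all_edges n - E))}"

primrec achlioptas :: "nat \<Rightarrow> nat \<Rightarrow> algorithm \<Rightarrow> nat \<Rightarrow> history pmf" where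
  "achlioptas n K A 0 = return_pmf []"
| "achlioptas n K A (Suc t) =
     bind_pmf (achlioptas n K A t) (\<lambda>h.
       map_pmf (\<lambda>S. h @ [(S, A h S)]) (pmf_of_set (offers n K (graph_of h))))"

lemma finite_all_edges: "finite (all_edges n)"
  unfolding all_edges_def by (rule finite_subset[of _ "Pow {..<n}"]) auto

text \<open>The next two facts are the side conditions under which \<open>pmf_of_set\<close> is uniform.\<close>

lemma finite_offers: "finite (offers n K E)"
  unfolding offers_def
  by (rule finite_subset[of _ "Pow (all_edges n)"]) (auto simp: finite_all_edges)

lemma offers_nonempty: "offers n K E \<noteq> {}"
proof -
  have "min K (card (all_edges n - E)) \<le> card (all_edges n - E)" by simp
  then obtain S where "S \<subseteq> all_edges n - E" "card S = min K (card (all_edges n - E))"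
    by (meson obtain_subset_with_card_n)
  then show ?thesis unfolding offers_def by blast
qed

end

theory Submission
  imports Defs
begin

text \<open>
  Call a graph property a milestone.  If the milestones form a chain such that from every graph that
  has reached one of them but not the next, at least \<open>g\<close> single edges lead to the next, then an
  algorithm that picks such an edge whenever it is offered wastes on average at most \<open>n\<^sup>2 / (2 K g)\<close>
  rounds on this step.  Three families of milestones lead to a Hamilton cycle.

  First, paths are joined until a single path covers all but \<open>o(n)\<close> vertices.  With \<open>r\<close> paths left,
  two of them may be joined at any of their first \<open>1 + a / r\<close> vertices, the initial segments being
  given up; this provides enough edges even when few paths are left, and costs only
  \<open>2 a / r\<close> vertices per step.

  Secondly, on the remaining \<open>w = o(n)\<close> vertices (and one end of the path) every vertex obtains \<open>20\<close>
  out-neighbours such that sets of size at most \<open>w / 12\<close> expand.  The union bound for random choices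
  is derandomised by conditional expectations, with a factor \<open>2\<close> to spare per choice, so that at
  least half of the possible targets are admissible.

  Finally, a path inside this expander that starts at the end of the long path is extended vertex by
  vertex.  By Posa's rotations it has more than \<open>w / 12\<close> possible ends, all of which may be extended,
  and in the last step be joined to the other end of the long path.
\<close>

section \<open>Chains of boosters\<close>

lemma binomial_ratio_le:
  fixes a b k :: nat
  assumes "b \<le> a"
  shows "(b choose k) * a ^ k \<le> (a choose k) * b ^ k"
proof (induction k)
  case (Suc k)
  have absorb: "Suc k * (m choose Suc k) = (m - k) * (m choose k)" for m
    by (metis binomial_absorb_comp binomial_absorption mult.commute)
  \<comment> \<open>The quotient of the two binomial coefficients is a product of factors
    \<open>(b - k) / (a - k)\<close>, and each of them is at most \<open>b / a\<close>.\<close>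
  have "(b - k) * a \<le> (a - k) * b"
  proof (cases "k \<le> b")
    case True
    then have "(b - k) * a = b * a - k * a" "(a - k) * b = a * b - k * b"
      by (simp_all add: diff_mult_distrib)
    moreover have "k * b \<le> k * a" using assms by simp
    ultimately show ?thesis by (metis diff_le_mono2 mult.commute)
  qed simp
  then have "((b - k) * a) * ((b choose k) * a ^ k) \<le> ((a - k) * b) * ((a choose k) * b ^ k)"
    using Suc by (rule mult_le_mono)
  then have "(Suc k * (b choose Suc k)) * a ^ Suc k \<le> (Suc k * (a choose Suc k)) * b ^ Suc k"
    unfolding absorb by (simp add: algebra_simps)
  then show ?case
    by (simp only: mult.assoc) (metis mult_le_cancel1 zero_less_Suc)
qed auto

text \<open>Writing \<open>\<gamma>\<close> for the density of \<open>G\<close> in \<open>N\<close>,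
  a miss has probability at most \<open>(1 - \<gamma>) ^ K\<close>, while Bernoulli gives
  \<open>1 + K * \<gamma> \<le> (1 + \<gamma>) ^ K\<close>; the product of the two bounds is at most
  1. In this form the bound turns directly into one on the expected number of misses before a hit,
  namely \<open>1 / (K * \<gamma>)\<close>.\<close>

lemma prob_miss_le:
  fixes N G :: "'a set" and K :: nat
  assumes fin: "finite N" and sub: "G \<subseteq> N" and ne: "G \<noteq> {}"
  defines "\<O> \<equiv> {S. S \<subseteq> N \<and> card S = min K (card N)}"
  shows "measure_pmf.prob (pmf_of_set \<O>) {S. S \<inter> G = {}} * (1 + K * card G / card N) \<le> 1"
proof -
  let ?k = "min K (card N)"
  have fG: "finite G" using fin sub finite_subset by blast
  have gN: "card G \<le> card N" using fin sub card_mono by blast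
  have g0: "card G > 0" using fG ne by (simp add: card_gt_0_iff)
  have cO: "card \<O> = card N choose ?k" unfolding \<O>_def by (rule n_subsets[OF fin])
  have pos: "card N choose ?k > 0" by simp
  have finO: "finite \<O>" using pos cO card_gt_0_iff by metis
  have neO: "\<O> \<noteq> {}" using pos cO by (metis card.empty less_irrefl)
  have "\<O> \<inter> {S. S \<inter> G = {}} = {S. S \<subseteq> N - G \<and> card S = ?k}" unfolding \<O>_def by auto
  then have cm: "card (\<O> \<inter> {S. S \<inter> G = {}}) = (card N - card G) choose ?k"
    using fin sub fG by (simp add: n_subsets card_Diff_subset)
  have q: "measure_pmf.prob (pmf_of_set \<O>) {S. S \<inter> G = {}}
      = real ((card N - card G) choose ?k) / real (card N choose ?k)"
    by (simp add: measure_pmf_of_set[OF neO finO] cm cO)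
  show ?thesis
  proof (cases "K \<le> card N")
    case False
    \<comment> \<open>All of \<open>N\<close> is presented here, so missing \<open>G\<close> is
      impossible.\<close>
    then have "(card N - card G) choose ?k = 0" using g0 gN by (simp add: min_def)
    then show ?thesis unfolding q by (simp only: of_nat_0 div_0 mult_zero_left zero_le_one)
  next
    case True
    then have k: "?k = K" by simp
    define \<gamma> where "\<gamma> = real (card G) / card N"
    have N0: "real (card N) > 0" using g0 gN by simp
    have \<gamma>: "0 \<le> \<gamma>" "\<gamma> \<le> 1" using gN N0 by (auto simp: \<gamma>_def)
    have "real ((card N - card G) choose K) * real (card N) ^ K
        \<le> real (card N choose K) * real (card N - card G) ^ K"
      using binomial_ratio_le[of "card N - card G" "card N" K]
      by (metis diff_le_self of_nat_le_iff of_nat_mult of_nat_power)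
    then have "real ((card N - card G) choose K) / real (card N choose K)
        \<le> (real (card N - card G) / real (card N)) ^ K"
      using N0 pos k by (simp add: power_divide field_simps)
    also have "real (card N - card G) / real (card N) = 1 - \<gamma>"
      using N0 gN by (simp add: \<gamma>_def of_nat_diff field_simps)
    finally have "measure_pmf.prob (pmf_of_set \<O>) {S. S \<inter> G = {}} \<le> (1 - \<gamma>) ^ K"
      unfolding q k .
    then have "measure_pmf.prob (pmf_of_set \<O>) {S. S \<inter> G = {}} * (1 + K * \<gamma>)
        \<le> (1 - \<gamma>) ^ K * (1 + \<gamma>) ^ K"
      using \<gamma> Bernoulli_inequality[of \<gamma> K] by (intro mult_mono) auto
    also have "\<dots> = (1 - \<gamma>\<^sup>2) ^ K"
      by (simp add: power_mult_distrib[symmetric] power2_eq_square algebra_simps)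
    also have "\<dots> \<le> 1" using \<gamma> by (intro power_le_one) (auto simp: power_le_one)
    finally show ?thesis by (simp add: \<gamma>_def)
  qed
qed

lemma card_all_edges_le: "real (card (all_edges n)) \<le> real n ^ 2 / 2"
proof -
  have "card (all_edges n) = n choose 2"
    unfolding all_edges_def using n_subsets[of "{..<n}" 2] by simp
  moreover have "2 * (n choose 2) \<le> n * n"
  proof -
    have "2 * (n * (n - 1) div 2) \<le> n * (n - 1)" by simp
    also have "\<dots> \<le> n * n" by simp
    finally show ?thesis unfolding choose_two .
  qed
  ultimately have "real (2 * card (all_edges n)) \<le> real (n * n)"
    by (metis of_nat_le_iff)
  then show ?thesis by (simp add: power2_eq_square)
qed

lemma set_pmf_achlioptas:
  assumes "online_algorithm A" "h \<in> set_pmf (achlioptas n K A t)"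
  shows "length h = t \<and> graph_of h \<subseteq> all_edges n"
  using assms(2)
proof (induction t arbitrary: h)
  case (Suc t)
  then obtain h' S where h': "h' \<in> set_pmf (achlioptas n K A t)"
    and S: "S \<in> offers n K (graph_of h')" and h: "h = h' @ [(S, A h' S)]"
    by (auto simp: set_pmf_of_set[OF offers_nonempty finite_offers])
  have "S \<subseteq> all_edges n" using S by (auto simp: offers_def)
  then show ?case using Suc.IH[OF h'] h by (auto simp: graph_of_def)
qed (auto simp: graph_of_def)

lemma graph_of_snoc:
  "graph_of (h @ [(S, e)]) = (if e \<in> S then insert e (graph_of h) else graph_of h)"
  by (auto simp: graph_of_def)

section \<open>Booster chains, their concatenation, and the greedy algorithm\<close>

definition booster_chain ::
  "nat \<Rightarrow> (edge set \<Rightarrow> bool) \<Rightarrow> (edge set \<Rightarrow> bool) \<Rightarrow> nat \<Rightarrow> real \<Rightarrow>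
   (nat \<Rightarrow> edge set \<Rightarrow> bool) \<Rightarrow> (nat \<Rightarrow> real) \<Rightarrow> bool" where
  "booster_chain n P Q M c R g \<longleftrightarrow>
     (\<forall>E. E \<subseteq> all_edges n \<longrightarrow> P E \<longrightarrow> R 0 E) \<and> (\<forall>E. E \<subseteq> all_edges n \<longrightarrow> R M E \<longrightarrow> Q E) \<and>
     (\<forall>i E E'. i \<le> M \<longrightarrow> E \<subseteq> E' \<longrightarrow> R i E \<longrightarrow> R i E') \<and>
     (\<forall>i. i < M \<longrightarrow> 0 < g i) \<and>
     (\<forall>i E. i < M \<longrightarrow> E \<subseteq> all_edges n \<longrightarrow> R i E \<longrightarrow> \<not> R (Suc i) E \<longrightarrow>
        g i \<le> real (card {e \<in> all_edges n. R (Suc i) (insert e E)})) \<and>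
     (\<Sum>i<M. 1 / g i) \<le> c"

text \<open>
  Here \<open>M\<close> counts the steps, and up to the factor \<open>n\<^sup>2 / (2 K)\<close> the cost \<open>c\<close> bounds the expected
  number of rounds without progress.
\<close>

definition route :: "nat \<Rightarrow> (edge set \<Rightarrow> bool) \<Rightarrow> (edge set \<Rightarrow> bool) \<Rightarrow> nat \<Rightarrow> real \<Rightarrow> bool" where
  "route n P Q M c \<longleftrightarrow> (\<exists>R g. booster_chain n P Q M c R g)"

lemma booster_chainD:
  assumes "booster_chain n P Q M c R g"
  shows "\<And>E. E \<subseteq> all_edges n \<Longrightarrow> P E \<Longrightarrow> R 0 E"
    and "\<And>E. E \<subseteq> all_edges n \<Longrightarrow> R M E \<Longrightarrow> Q E"
    and "\<And>i E E'. i \<le> M \<Longrightarrow> E \<subseteq> E' \<Longrightarrow> R i E \<Longrightarrow> R i E'"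
    and "\<And>i. i < M \<Longrightarrow> 0 < g i"
    and "\<And>i E. i < M \<Longrightarrow> E \<subseteq> all_edges n \<Longrightarrow> R i E \<Longrightarrow> \<not> R (Suc i) E \<Longrightarrow>
        g i \<le> real (card {e \<in> all_edges n. R (Suc i) (insert e E)})"
    and "(\<Sum>i<M. 1 / g i) \<le> c"
  using assms by (simp_all add: booster_chain_def)

lemma routeI:
  fixes R :: "nat \<Rightarrow> edge set \<Rightarrow> bool" and g :: "nat \<Rightarrow> real"
  assumes "\<And>E. E \<subseteq> all_edges n \<Longrightarrow> P E \<Longrightarrow> R 0 E"
    and "\<And>E. E \<subseteq> all_edges n \<Longrightarrow> R M E \<Longrightarrow> Q E"
    and "\<And>i E E'. i \<le> M \<Longrightarrow> E \<subseteq> E' \<Longrightarrow> R i E \<Longrightarrow> R i E'"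
    and "\<And>i. i < M \<Longrightarrow> 0 < g i"
    and "\<And>i E. i < M \<Longrightarrow> E \<subseteq> all_edges n \<Longrightarrow> R i E \<Longrightarrow> \<not> R (Suc i) E \<Longrightarrow>
        g i \<le> real (card {e \<in> all_edges n. R (Suc i) (insert e E)})"
    and "(\<Sum>i<M. 1 / g i) \<le> c"
  shows "route n P Q M c"
  unfolding route_def booster_chain_def
  by (rule exI[of _ R], rule exI[of _ g], intro conjI allI impI) (fact assms)+

text \<open>The two chains are concatenated. At the seam the milestone \<open>R M\<close> is
  replaced by \<open>R' 0\<close>, which it implies by way of \<open>Q\<close>; so boosters towards
  \<open>R M\<close> remain boosters in the joint chain.\<close>

lemma route_trans:
  assumes "route n P Q M c" "route n Q S M' c'"
  shows "route n P S (M + M') (c + c')"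
proof -
  obtain R g where "booster_chain n P Q M c R g"
    using assms(1) unfolding route_def by blast
  note R = booster_chainD[OF this]
  obtain R' g' where "booster_chain n Q S M' c' R' g'"
    using assms(2) unfolding route_def by blast
  note R' = booster_chainD[OF this]
  define T where "T i = (if i < M then R i else R' (i - M))" for i
  define k where "k i = (if i < M then g i else g' (i - M))" for i
  have RT: "T i E" if "i \<le> M" "E \<subseteq> all_edges n" "R i E" for i E
    using that R(2) R'(1) by (cases "i = M") (auto simp: T_def)
  show ?thesis
  proof (rule routeI[where R = T and g = k])
    show "T 0 E" if "E \<subseteq> all_edges n" "P E" for E using R(1) RT that by blast
    show "S E" if "E \<subseteq> all_edges n" "T (M + M') E" for E using that R'(2) by (simp add: T_def)
    show "T i E'" if "i \<le> M + M'" "E \<subseteq> E'" "T i E" for i E E'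
      using that R(3)[of i E E'] R'(3)[of "i - M" E E'] by (auto simp: T_def split: if_splits)
    show "0 < k i" if "i < M + M'" for i using that R(4) R'(4) by (auto simp: k_def)
    show "k i \<le> real (card {e \<in> all_edges n. T (Suc i) (insert e E)})"
      if i: "i < M + M'" and E: "E \<subseteq> all_edges n" and TE: "T i E" "\<not> T (Suc i) E" for i E
    proof (cases "i < M")
      case True
      have "g i \<le> real (card {e \<in> all_edges n. R (Suc i) (insert e E)})"
        using True E TE RT[of "Suc i" E] by (intro R(5)) (auto simp: T_def)
      also have "\<dots> \<le> real (card {e \<in> all_edges n. T (Suc i) (insert e E)})"
        using True E RT[of "Suc i"]
        by (intro of_nat_mono card_mono) (auto simp: finite_all_edges)
      finally show ?thesis using True by (simp add: k_def)
    next
      case False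
      then show ?thesis using i E TE R'(5)[of "i - M" E] by (simp add: T_def k_def Suc_diff_le)
    qed
    have "(\<Sum>i<M + M'. 1 / k i) = (\<Sum>i<M. 1 / k i) + (\<Sum>i<M'. 1 / k (M + i))"
      using sum.atLeastLessThan_concat[of 0 M "M + M'" "\<lambda>i. 1 / k i"]
        sum.shift_bounds_nat_ivl[of "\<lambda>i. 1 / k i" 0 M M']
      by (simp add: atLeast0LessThan add.commute)
    also have "\<dots> \<le> c + c'" using R(6) R'(6) by (simp add: k_def)
    finally show "(\<Sum>i<M + M'. 1 / k i) \<le> c + c'" .
  qed
qed

text \<open>
  Choosing an edge that raises the level whenever one is offered makes
  (number of rounds without progress so far) + (expected number of further such rounds)
  a supermartingale; Markov's inequality then bounds the probability of exceeding the slack \<open>D\<close>.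
\<close>

lemma route_algorithm:
  assumes route: "route n P Q M c" and P0: "P {}" and K: "K > 0" and D: "D > 0"
  shows "\<exists>A. online_algorithm A \<and>
    measure_pmf.prob (achlioptas n K A (M + D)) {h. Q (graph_of h)}
      \<ge> 1 - real n ^ 2 * c / (2 * K * D)"
proof -
  obtain R g where "booster_chain n P Q M c R g"
    using route unfolding route_def by blast
  note chain = booster_chainD[OF this]
  note R0 = chain(1) and RM = chain(2) and mono = chain(3) and g = chain(4)
    and boost = chain(5) and c = chain(6)
  \<comment> \<open>Every graph has a level, because level 0 already holds for the empty graph and
    milestones survive the addition of edges.\<close>
  have R0: "R 0 E" for E using mono[of 0 "{}" E] R0[of "{}"] P0 by blast
  define lev where "lev E = (GREATEST i. i \<le> M \<and> R i E)" for E
  have lev: "lev E \<le> M \<and> R (lev E) E" for E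
    unfolding lev_def by (rule GreatestI_nat[where k = 0 and b = M]) (auto simp: R0)
  have lev_ge: "i \<le> lev E" if "i \<le> M" "R i E" for i E
    unfolding lev_def by (rule Greatest_le_nat[where b = M]) (use that in auto)
  define G where "G E = {e \<in> all_edges n. R (Suc (lev E)) (insert e E)}" for E
  define A :: algorithm where
    "A h S = (if S \<inter> G (graph_of h) \<noteq> {} then SOME e. e \<in> S \<inter> G (graph_of h) else SOME e. e \<in> S)"
    for h S
  have A_G: "A h S \<in> S \<inter> G (graph_of h)" if "S \<inter> G (graph_of h) \<noteq> {}" for h S
    using that unfolding A_def by (metis (mono_tags, lifting) ex_in_conv someI_ex)
  have A: "online_algorithm A"
    unfolding online_algorithm_def
  proof (intro allI impI)
    fix h :: history and S :: "edge set" assume "S \<noteq> {}"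
    then show "A h S \<in> S" using A_G[of S h]
      by (cases "S \<inter> G (graph_of h) = {}") (auto simp: A_def some_in_eq)
  qed
  \<comment> \<open>Bounds the expected number of misses at level \<open>i\<close>;
    \<open>\<Psi> i\<close> sums these bounds over the levels still ahead.\<close>
  define f where "f i = real n ^ 2 / (2 * K * g i)" for i
  have f0: "f i \<ge> 0" if "i < M" for i using g[OF that] by (simp add: f_def)
  define \<Psi> where "\<Psi> i = (\<Sum>j=i..<M. f j)" for i
  have \<Psi>_mono: "\<Psi> j \<le> \<Psi> i" if "i \<le> j" for i j
    unfolding \<Psi>_def by (rule sum_mono2) (use that f0 in auto)
  have \<Psi>_Suc: "\<Psi> i = f i + \<Psi> (Suc i)" if "i < M" for i
    unfolding \<Psi>_def using that by (simp add: sum.atLeast_Suc_lessThan)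
  have \<Psi>0: "\<Psi> i \<ge> 0" for i unfolding \<Psi>_def using f0 by (intro sum_nonneg) auto
  \<comment> \<open>Rounds wasted so far plus the bound for those to come. Rounds after level
    \<open>M\<close> must not count as wasted, hence the value 0 there. A round may raise the level
    by more than one, so the level can exceed the number of rounds; the truncated difference is then
    0.\<close>
  define Y where "Y h = (if lev (graph_of h) = M then 0
      else real (length h - lev (graph_of h)) + \<Psi> (lev (graph_of h)))" for h :: history
  have Y_le: "Y h \<le> real (length h - i) + \<Psi> i" if "i \<le> lev (graph_of h)" for h i
    using that \<Psi>0[of i] \<Psi>_mono[OF that] unfolding Y_def by (auto intro!: add_mono)
  have lev_snoc: "lev (graph_of h) \<le> lev (graph_of (h @ [x]))" for h x
    using lev[of "graph_of h"] mono[of "lev (graph_of h)" "graph_of h" "graph_of (h @ [x])"]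
    by (intro lev_ge) (auto simp: graph_of_def)
  have step: "(\<integral>\<^sup>+S. ennreal (Y (h @ [(S, A h S)])) \<partial>pmf_of_set (offers n K (graph_of h))) \<le> ennreal (Y h)"
    if h: "graph_of h \<subseteq> all_edges n" for h
  proof (cases "lev (graph_of h) = M")
    case True
    then have "lev (graph_of (h @ [x])) = M" for x using lev lev_snoc by (metis le_antisym)
    then show ?thesis by (simp add: Y_def)
  next
    case False
    define E where "E = graph_of h"
    define i where "i = lev E"
    have i: "i < M" using False lev unfolding i_def E_def by (metis le_neq_implies_less)
    have nR: "\<not> R (Suc i) E" using lev_ge[of "Suc i" E] i unfolding i_def by auto
    have RiE: "R i E" using lev unfolding i_def by blast
    have gG: "g i \<le> real (card (G E))" using boost[OF i _ RiE nR] h unfolding G_def i_def E_def by blast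
    have GE: "G E \<subseteq> all_edges n - E"
      using nR by (auto simp: G_def i_def insert_absorb)
    have Gne: "G E \<noteq> {}" using gG g[OF i] by auto
    let ?N = "all_edges n - E"
    have finN: "finite ?N" by (simp add: finite_all_edges)
    have N0: "card ?N > 0" using GE Gne finN card_gt_0_iff by blast
    define q where "q = measure_pmf.prob (pmf_of_set (offers n K E)) {S. S \<inter> G E = {}}"
    have q0: "q \<ge> 0" by (simp add: q_def)
    have q: "q * (1 + K * card (G E) / card ?N) \<le> 1"
      using prob_miss_le[OF finN GE Gne, of K] unfolding q_def offers_def by simp
    have nN: "real (card ?N) \<le> real n ^ 2 / 2"
      using card_all_edges_le[of n] card_mono[OF finite_all_edges, of ?N n] by fastforce
    then have n0: "real n ^ 2 > 0" using N0 by linarith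
    have fi: "f i > 0" using g[OF i] K n0 by (simp add: f_def)
    \<comment> \<open>There are at most \<open>n^2 / 2\<close> non-edges, so the boosters have
      density at least \<open>g i / (n^2 / 2)\<close> among them.\<close>
    have "1 / f i = K * g i / (real n ^ 2 / 2)" by (simp add: f_def)
    also have "\<dots> \<le> K * card (G E) / card ?N"
      using gG N0 nN K g[OF i] by (intro frac_le mult_left_mono) auto
    finally have "q * (1 + 1 / f i) \<le> q * (1 + K * card (G E) / card ?N)"
      using q0 by (intro mult_left_mono) auto
    with q have "q * (1 + 1 / f i) \<le> 1" by linarith
    \<comment> \<open>This is the supermartingale inequality: a miss raises \<open>Y\<close> by at
      most \<open>1 + f i\<close> above the bound for a hit, and the bound for a hit lies
      \<open>f i\<close> below the present value.\<close>
    then have qf: "q * (1 + f i) \<le> f i" using fi by (simp add: field_simps)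
    let ?L = "real (length h - i)"
    have pt: "Y (h @ [(S, A h S)]) \<le> ?L + \<Psi> (Suc i) + (1 + f i) * indicator {S. S \<inter> G E = {}} S" for S
    proof (cases "S \<inter> G E = {}")
      case True
      have "Y (h @ [(S, A h S)]) \<le> real (Suc (length h) - i) + \<Psi> i"
        using Y_le[OF lev_snoc[of h "(S, A h S)"]] unfolding i_def E_def by simp
      also have "real (Suc (length h) - i) \<le> 1 + ?L" by linarith
      finally show ?thesis using True \<Psi>_Suc[OF i] by simp
    next
      case False
      then have "A h S \<in> S" "A h S \<in> G E" using A_G[of S h] unfolding E_def by auto
      then have "R (Suc i) (graph_of (h @ [(S, A h S)]))"
        by (simp add: graph_of_snoc G_def i_def E_def)
      then have "Suc i \<le> lev (graph_of (h @ [(S, A h S)]))" using i by (intro lev_ge) auto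
      from Y_le[OF this] show ?thesis using False by simp
    qed
    have "(\<integral>\<^sup>+S. ennreal (Y (h @ [(S, A h S)])) \<partial>pmf_of_set (offers n K E))
       \<le> (\<integral>\<^sup>+S. ennreal (?L + \<Psi> (Suc i)) + ennreal (1 + f i) * indicator {S. S \<inter> G E = {}} S
            \<partial>pmf_of_set (offers n K E))"
    proof (rule nn_integral_mono)
      fix S
      have "ennreal (Y (h @ [(S, A h S)]))
        \<le> ennreal (?L + \<Psi> (Suc i) + (1 + f i) * indicator {S. S \<inter> G E = {}} S)"
        using pt by (rule ennreal_leI)
      also have "\<dots> = ennreal (?L + \<Psi> (Suc i)) + ennreal (1 + f i) * indicator {S. S \<inter> G E = {}} S"
        using fi \<Psi>0 by (auto simp: indicator_def ennreal_plus[symmetric] simp del: ennreal_plus)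
      finally show "ennreal (Y (h @ [(S, A h S)]))
        \<le> ennreal (?L + \<Psi> (Suc i)) + ennreal (1 + f i) * indicator {S. S \<inter> G E = {}} S" .
    qed
    also have "\<dots> = ennreal (?L + \<Psi> (Suc i)) + ennreal (1 + f i) * ennreal q"
      by (subst nn_integral_add) (auto simp: nn_integral_cmult measure_pmf.emeasure_eq_measure q_def)
    also have "\<dots> = ennreal (?L + \<Psi> (Suc i) + (1 + f i) * q)"
      using fi \<Psi>0 q0 by (simp add: ennreal_mult'[symmetric] ennreal_plus[symmetric] del: ennreal_plus)
    also have "\<dots> \<le> ennreal (Y h)"
      using qf False \<Psi>_Suc[OF i] unfolding Y_def i_def E_def
      by (intro ennreal_leI) (simp add: mult.commute)
    finally show ?thesis unfolding E_def .
  qed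
  have EY: "(\<integral>\<^sup>+h. ennreal (Y h) \<partial>achlioptas n K A t) \<le> ennreal (\<Psi> 0)" for t
  proof (induction t)
    case 0
    have "Y [] \<le> \<Psi> 0" using Y_le[of 0 "[]"] by simp
    then show ?case by (simp add: ennreal_leI)
  next
    case (Suc t)
    have "(\<integral>\<^sup>+h. ennreal (Y h) \<partial>achlioptas n K A (Suc t))
       = (\<integral>\<^sup>+h. (\<integral>\<^sup>+S. ennreal (Y (h @ [(S, A h S)])) \<partial>pmf_of_set (offers n K (graph_of h))) \<partial>achlioptas n K A t)"
      by (simp add: nn_integral_map_pmf)
    also have "\<dots> \<le> (\<integral>\<^sup>+h. ennreal (Y h) \<partial>achlioptas n K A t)"
      using set_pmf_achlioptas[OF A] by (intro nn_integral_mono_AE AE_pmfI step) blast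
    finally show ?case using Suc by (rule order_trans)
  qed
  define T where "T = M + D"
  let ?\<mu> = "achlioptas n K A T"
  \<comment> \<open>After \<open>M + D\<close> rounds, a graph that is still below level
    \<open>M\<close> has seen more than \<open>D\<close> rounds that are not accounted for by a
    level, so \<open>Y\<close> is at least \<open>D\<close>.\<close>
  have fail: "ennreal D * indicator {h. \<not> Q (graph_of h)} h \<le> ennreal (Y h)"
    if "h \<in> set_pmf ?\<mu>" for h
  proof (cases "Q (graph_of h)")
    case False
    have h: "length h = T" "graph_of h \<subseteq> all_edges n" using set_pmf_achlioptas[OF A that] by auto
    have "lev (graph_of h) \<noteq> M" using False RM h lev by metis
    then have "Y h \<ge> real (T - lev (graph_of h))" using h \<Psi>0 by (simp add: Y_def)
    moreover have "T - lev (graph_of h) \<ge> D" using lev[of "graph_of h"] unfolding T_def by linarith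
    ultimately have "real D \<le> Y h" by linarith
    then show ?thesis using False by (simp add: ennreal_leI)
  qed simp
  have "ennreal D * emeasure ?\<mu> {h. \<not> Q (graph_of h)} 
     = (\<integral>\<^sup>+h. ennreal D * indicator {h. \<not> Q (graph_of h)} h \<partial>?\<mu>)"
    by (simp add: nn_integral_cmult)
  also have "\<dots> \<le> (\<integral>\<^sup>+h. ennreal (Y h) \<partial>?\<mu>)"
    using fail by (intro nn_integral_mono_AE) (auto simp: AE_measure_pmf_iff)
  also have "\<dots> \<le> ennreal (\<Psi> 0)" by (rule EY)
  finally have "ennreal (D * measure_pmf.prob ?\<mu> {h. \<not> Q (graph_of h)}) \<le> ennreal (\<Psi> 0)"
    by (simp add: measure_pmf.emeasure_eq_measure ennreal_mult')
  then have 1: "D * measure_pmf.prob ?\<mu> {h. \<not> Q (graph_of h)} \<le> \<Psi> 0"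
    using \<Psi>0[of 0] by simp
  have "\<Psi> 0 = real n ^ 2 / (2 * K) * (\<Sum>i<M. 1 / g i)"
    unfolding \<Psi>_def f_def by (simp add: sum_distrib_left atLeast0LessThan)
  also have "\<dots> \<le> real n ^ 2 / (2 * K) * c" using c by (intro mult_left_mono) auto
  finally have "D * measure_pmf.prob ?\<mu> {h. \<not> Q (graph_of h)} \<le> real n ^ 2 / (2 * K) * c"
    using 1 by linarith
  then have "measure_pmf.prob ?\<mu> {h. \<not> Q (graph_of h)} \<le> real n ^ 2 * c / (2 * K * D)"
    using D K by (simp add: field_simps)
  moreover have "measure_pmf.prob ?\<mu> {h. Q (graph_of h)} = 1 - measure_pmf.prob ?\<mu> {h. \<not> Q (graph_of h)}"
    using measure_pmf.prob_compl[of "{h. \<not> Q (graph_of h)}" ?\<mu>]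
    by (simp add: Compl_eq_Diff_UNIV[symmetric] Collect_neg_eq[symmetric])
  ultimately show ?thesis using A unfolding T_def by (intro exI[of _ A]) auto
qed

section \<open>Rotations of paths in expanders\<close>

fun path_edges :: "nat list \<Rightarrow> edge set" where
  "path_edges (u # v # p) = insert {u, v} (path_edges (v # p))"
| "path_edges _ = {}"

lemma path_edges_Cons:
  "path_edges (u # p) = (if p = [] then {} else insert {u, hd p} (path_edges p))"
  by (cases p) auto

lemma path_edges_append:
  "path_edges (p @ q) = path_edges p \<union> path_edges q \<union> (if p = [] \<or> q = [] then {} else {{last p, hd q}})"
  by (induction p) (auto simp: path_edges_Cons)

lemma path_edges_rev [simp]: "path_edges (rev p) = path_edges p"
  by (induction p) (auto simp: path_edges_append path_edges_Cons last_rev insert_commute)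

lemma path_edges_subset: "e \<in> path_edges p \<Longrightarrow> e \<subseteq> set p"
  by (induction p) (auto simp: path_edges_Cons split: if_splits)

lemma path_edges_nth: "Suc i < length p \<Longrightarrow> {p ! i, p ! Suc i} \<in> path_edges p"
proof (induction p arbitrary: i)
  case (Cons u p)
  then show ?case by (cases i) (auto simp: path_edges_Cons hd_conv_nth)
qed simp

definition is_path :: "edge set \<Rightarrow> nat list \<Rightarrow> bool" where
  "is_path E p \<longleftrightarrow> distinct p \<and> path_edges p \<subseteq> E"

lemma is_path_mono: "is_path E p \<Longrightarrow> E \<subseteq> E' \<Longrightarrow> is_path E' p"
  by (auto simp: is_path_def)

lemma is_path_append:
  "is_path E (p @ q) \<longleftrightarrow> is_path E p \<and> is_path E q \<and> set p \<inter> set q = {} \<and>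
     (p = [] \<or> q = [] \<or> {last p, hd q} \<in> E)"
  by (auto simp: is_path_def path_edges_append)

lemma card_path_neighbours_le:
  assumes "distinct p"
  shows "card {z. {z, y} \<in> path_edges p} \<le> 2" "finite {z. {z, y} \<in> path_edges p}"
proof -
  have "\<exists>a b. {z. {z, y} \<in> path_edges p} \<subseteq> {a, b}"
  proof (cases "y \<in> set p")
    case True
    then obtain A B where p: "p = A @ y # B" by (meson split_list)
    have "y \<notin> set A" "y \<notin> set B" using assms p by auto
    then have "{z. {z, y} \<in> path_edges p} \<subseteq> {last A, hd B}"
      using p path_edges_subset[of _ A] path_edges_subset[of _ B]
      by (fastforce simp: path_edges_append path_edges_Cons doubleton_eq_iff split: if_splits)
    then show ?thesis by blast
  next
    case False
    then have "{z. {z, y} \<in> path_edges p} \<subseteq> {y, y}" by (auto dest: path_edges_subset)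
    then show ?thesis by blast
  qed
  then obtain a b where ab: "{z. {z, y} \<in> path_edges p} \<subseteq> {a, b}" by blast
  then show "finite {z. {z, y} \<in> path_edges p}" by (rule finite_subset) simp
  have "card {a, b} \<le> 2" by (simp add: card_insert_if)
  then show "card {z. {z, y} \<in> path_edges p} \<le> 2"
    using card_mono[OF _ ab] by fastforce
qed

text \<open>The edge from the end \<open>last B\<close> back to \<open>u\<close> replaces the edge
  from \<open>u\<close> to \<open>hd B\<close>, which makes \<open>hd B\<close> the new end. The
  first vertex stays fixed, since it will be the junction with the long path.\<close>

inductive rotation :: "edge set \<Rightarrow> nat list \<Rightarrow> nat list \<Rightarrow> bool" for E p where
  refl: "rotation E p p"
| rotate: "rotation E p (A @ u # B) \<Longrightarrow> B \<noteq> [] \<Longrightarrow> {u, last B} \<in> E \<Longrightarrow> rotation E p (A @ u # rev B)"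

lemma rotation_path:
  assumes "rotation E p q" "is_path E p"
  shows "is_path E q \<and> set q = set p \<and> hd q = hd p \<and> length q = length p"
  using assms
proof (induction rule: rotation.induct)
  case (rotate A u B)
  have "is_path E (A @ [u] @ rev B)"
    using rotate by (auto simp: is_path_def path_edges_append path_edges_Cons hd_rev)
  moreover have "hd (A @ u # rev B) = hd (A @ u # B)" by (cases A) auto
  ultimately show ?case using rotate by simp
qed simp

definition endpoints :: "edge set \<Rightarrow> nat list \<Rightarrow> nat set" where
  "endpoints E p = last ` {q. rotation E p q}"

lemma endpoints_subset:
  assumes "is_path E p" "p \<noteq> []"
  shows "endpoints E p \<subseteq> set p"
proof
  fix y assume "y \<in> endpoints E p"
  then obtain q where q: "rotation E p q" "y = last q" by (auto simp: endpoints_def)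
  then show "y \<in> set p" using rotation_path[OF q(1) assms(1)] assms(2) by (metis last_in_set length_0_conv)
qed

text \<open>A rotation removes an edge between \<open>u\<close> and the new end and adds one between
  \<open>u\<close> and the old end. If the edges at \<open>z\<close> have been those of
  \<open>p\<close> so far, then \<open>u\<close> is not \<open>z\<close>, because \<open>p\<close>
  has no edge from \<open>z\<close> to an end; and \<open>z\<close> is itself not an end. So neither
  change touches \<open>z\<close>.\<close>

lemma rotation_preserves_edges:
  assumes "rotation E p q" "z \<notin> endpoints E p"
    and "\<And>y. y \<in> endpoints E p \<Longrightarrow> {z, y} \<notin> path_edges p"
    and "{z, x} \<in> path_edges q"
  shows "{z, x} \<in> path_edges p"
  using assms(1,4)
proof (induction arbitrary: x rule: rotation.induct)
  case (rotate A u B)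
  have "rotation E p (A @ u # rev B)" using rotate.hyps by (rule rotation.rotate)
  then have ends: "last B \<in> endpoints E p" "hd B \<in> endpoints E p"
    using rotate.hyps by (force simp: endpoints_def last_rev image_iff)+
  have "{u, hd B} \<in> path_edges (A @ u # B)"
    using rotate.hyps by (simp add: path_edges_append path_edges_Cons)
  with rotate.IH ends(2) assms(3) have "z \<noteq> u" by blast
  moreover have "z \<noteq> last B" using ends(1) assms(2) by blast
  ultimately have "{z, x} \<noteq> {u, last B}" by (auto simp: doubleton_eq_iff)
  then have "{z, x} \<in> path_edges (A @ u # B)"
    using rotate.prems rotate.hyps
    by (auto simp: path_edges_append path_edges_Cons hd_rev split: if_splits)
  then show ?case by (rule rotate.IH)
qed simp

definition nbrs :: "edge set \<Rightarrow> nat set \<Rightarrow> nat set \<Rightarrow> nat set" where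
  "nbrs E W S = {z \<in> W - S. \<exists>y\<in>S. {y, z} \<in> E}"

text \<open>Every neighbour \<open>z\<close> of the set of ends outside this set is next to an end
  on the original path \<open>p\<close>, and each end has at most two neighbours on
  \<open>p\<close>.\<close>

lemma posa:
  assumes p: "is_path E p" "p \<noteq> []" and pW: "set p \<subseteq> W"
    and max: "\<And>q z. rotation E p q \<Longrightarrow> z \<in> W - set p \<Longrightarrow> {last q, z} \<notin> E"
  shows "card (nbrs E W (endpoints E p)) \<le> 2 * card (endpoints E p)"
proof -
  let ?R = "endpoints E p"
  have finR: "finite ?R" using finite_subset[OF endpoints_subset[OF p]] by simp
  have "nbrs E W ?R \<subseteq> (\<Union>y\<in>?R. {z. {z, y} \<in> path_edges p})"
  proof
    fix z assume "z \<in> nbrs E W ?R"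
    then obtain q where q: "rotation E p q" "{last q, z} \<in> E" and z: "z \<in> W" "z \<notin> ?R"
      by (auto simp: nbrs_def endpoints_def)
    \<comment> \<open>No rotated path extends out of \<open>p\<close>, so \<open>z\<close> lies on
      \<open>q\<close>; rotating at \<open>z\<close> turns its successor \<open>hd B\<close> into an
      end.\<close>
    have "z \<in> set q" using max[OF q(1), of z] q z rotation_path[OF q(1) p(1)] by auto
    then obtain A B where qAB: "q = A @ z # B" by (meson split_list)
    have B: "B \<noteq> []" using z(2) q(1) qAB by (force simp: endpoints_def)
    have "rotation E p (A @ z # rev B)"
      using q B unfolding qAB by (intro rotation.rotate) (auto simp: insert_commute)
    then have hd: "hd B \<in> ?R" using B by (force simp: endpoints_def image_iff last_rev)
    have "{z, hd B} \<in> path_edges q" using B by (simp add: qAB path_edges_append path_edges_Cons)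
    \<comment> \<open>If no end were next to \<open>z\<close> on \<open>p\<close>, the edges at
      \<open>z\<close> would have survived all rotations, among them the one to the end
      \<open>hd B\<close>.\<close>
    then have "\<exists>y\<in>?R. {z, y} \<in> path_edges p"
      using rotation_preserves_edges[OF q(1) z(2)] hd by blast
    then show "z \<in> (\<Union>y\<in>?R. {z. {z, y} \<in> path_edges p})" by blast
  qed
  then have "card (nbrs E W ?R) \<le> card (\<Union>y\<in>?R. {z. {z, y} \<in> path_edges p})"
    using p finR by (intro card_mono) (auto simp: is_path_def card_path_neighbours_le)
  also have "\<dots> \<le> (\<Sum>y\<in>?R. card {z. {z, y} \<in> path_edges p})" by (rule card_UN_le[OF finR])
  also have "\<dots> \<le> (\<Sum>y\<in>?R. 2)"
    using p by (intro sum_mono) (auto simp: is_path_def card_path_neighbours_le)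
  finally show ?thesis by simp
qed

section \<open>Spines and the expanders on the remaining vertices\<close>

definition expanding :: "edge set \<Rightarrow> nat set \<Rightarrow> bool" where
  "expanding E W \<longleftrightarrow> (\<forall>S \<subseteq> W. S \<noteq> {} \<longrightarrow> 12 * card S \<le> card W \<longrightarrow> 2 * card S < card (nbrs E W S))"

lemma expanding_mono:
  assumes "expanding E W" "E \<subseteq> E'" "finite W"
  shows "expanding E' W"
proof -
  have "card (nbrs E W S) \<le> card (nbrs E' W S)" for S
    using assms by (intro card_mono) (auto simp: nbrs_def)
  then show ?thesis using assms(1) unfolding expanding_def by (meson less_le_trans)
qed

text \<open>
  The last vertex of \<open>P\<close> also belongs to \<open>rest n P\<close> below, so that paths in \<open>rest n P\<close> starting there
  prolong \<open>P\<close>; hence \<open>n + 1 - w\<close> vertices on \<open>P\<close> leave a set of \<open>w\<close> elements.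
\<close>

definition spine :: "nat \<Rightarrow> nat \<Rightarrow> edge set \<Rightarrow> nat list \<Rightarrow> bool" where
  "spine n w E P \<longleftrightarrow> is_path E P \<and> set P \<subseteq> {..<n} \<and> length P = n + 1 - w"

definition rest :: "nat \<Rightarrow> nat list \<Rightarrow> nat set" where
  "rest n P = insert (last P) ({..<n} - set P)"

lemma finite_rest [simp]: "finite (rest n P)"
  by (simp add: rest_def)

lemma card_rest:
  assumes "spine n w E P" "1 \<le> w" "w \<le> n"
  shows "card (rest n P) = w" "rest n P \<subseteq> {..<n}"
proof -
  have P: "P \<noteq> []" "distinct P" "set P \<subseteq> {..<n}" "length P = n + 1 - w"
    using assms by (auto simp: spine_def is_path_def)
  have "card ({..<n} - set P) = n - (n + 1 - w)"
    using P by (simp add: card_Diff_subset distinct_card)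
  then show "card (rest n P) = w" using P assms by (simp add: rest_def)
  have "last P \<in> {..<n}" using P(3) last_in_set[OF P(1)] by (rule subsetD)
  then show "rest n P \<subseteq> {..<n}" by (auto simp: rest_def)
qed

definition expander_spine :: "nat \<Rightarrow> nat \<Rightarrow> edge set \<Rightarrow> bool" where
  "expander_spine n w E \<longleftrightarrow> (\<exists>P. spine n w E P \<and> expanding E (rest n P))"

definition spine_tail :: "nat \<Rightarrow> nat \<Rightarrow> edge set \<Rightarrow> nat list \<Rightarrow> nat list \<Rightarrow> bool" where
  "spine_tail n w E P p \<longleftrightarrow> spine n w E P \<and> expanding E (rest n P) \<and> is_path E p \<and>
     set p \<subseteq> rest n P \<and> p \<noteq> [] \<and> hd p = last P"

lemma spine_tail_mono: "spine_tail n w E P p \<Longrightarrow> E \<subseteq> E' \<Longrightarrow> spine_tail n w E' P p"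
  by (auto simp: spine_tail_def spine_def intro: is_path_mono expanding_mono)

text \<open>By \<open>posa\<close> the ends have at most twice as many neighbours as there are ends,
  so the expansion property cannot apply to them: they must be too many for it.\<close>

lemma card_endpoints:
  assumes "spine_tail n w E P p" and w: "1 \<le> w" "w \<le> n"
    and max: "\<And>q z. rotation E p q \<Longrightarrow> z \<in> rest n P - set p \<Longrightarrow> {last q, z} \<notin> E"
  shows "real w / 12 \<le> card (endpoints E p)" "endpoints E p \<subseteq> set p"
proof -
  have p: "spine n w E P" "expanding E (rest n P)" "is_path E p" "set p \<subseteq> rest n P" "p \<noteq> []"
    using assms(1) by (auto simp: spine_tail_def)
  show R: "endpoints E p \<subseteq> set p" using p by (intro endpoints_subset)
  have "endpoints E p \<noteq> {}" by (auto simp: endpoints_def intro: rotation.refl)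
  then have "12 * card (endpoints E p) > w"
    using p R posa[OF p(3,5,4) max] card_rest[OF p(1) w] unfolding expanding_def
    by (metis leD not_le order_trans)
  then show "real w / 12 \<le> card (endpoints E p)" by linarith
qed

section \<open>Extension to a Hamilton path and closure to a cycle\<close>

lemma sum_inverse_le_ln: "(\<Sum>k=1..n. 1 / real k) \<le> 1 + ln (real n)" if "n \<ge> 1"
  using that
proof (induction n rule: dec_induct)
  case (step n)
  have "ln (real n / real (Suc n)) \<le> real n / real (Suc n) - 1"
    using step by (intro ln_le_minus_one) auto
  then have "1 / real (Suc n) \<le> ln (real (Suc n)) - ln (real n)"
    using step by (simp add: ln_div field_simps)
  then show ?case using step by simp
qed simp

lemma sum_inverse_rev_le_ln:
  assumes "m \<ge> 1"
  shows "(\<Sum>i<m. 1 / real (m - i)) \<le> 1 + ln (real m)"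
proof -
  have "(\<Sum>i<m. 1 / real (m - i)) = (\<Sum>k=1..m. 1 / real k)"
    by (rule sum.reindex_bij_witness[of _ "\<lambda>k. m - k" "\<lambda>i. m - i"]) auto
  then show ?thesis using sum_inverse_le_ln[OF assms] by simp
qed

text \<open>Level \<open>i\<close> is a tail with \<open>i + 1\<close> vertices. Any of its at least
  \<open>w / 12\<close> possible ends may be joined to any of the \<open>w - 1 - i\<close> vertices
  not yet visited, so the cost is a harmonic sum.\<close>

lemma route_hamilton_path:
  assumes w: "2 \<le> w" "w \<le> n"
  shows "route n (expander_spine n w)
     (\<lambda>E. \<exists>P p. spine_tail n w E P p \<and> length p = w) (w - 1) (12 / w * (1 + ln w))"
proof -
  define R where "R i E \<longleftrightarrow> (\<exists>P p. spine_tail n w E P p \<and> length p = Suc i)" for i E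
  have boost: "real w / 12 * real (w - 1 - i) \<le> card {e \<in> all_edges n. R (Suc i) (insert e E)}"
    if i: "i < w - 1" and ex: "R i E" and nex: "\<not> R (Suc i) E" for i E
  proof -
    obtain P p where tail: "spine_tail n w E P p" and len: "length p = Suc i"
      using ex unfolding R_def by blast
    have p: "spine n w E P" "expanding E (rest n P)" "is_path E p" "set p \<subseteq> rest n P" "p \<noteq> []"
        "hd p = last P"
      using tail by (auto simp: spine_tail_def)
    have w1: "1 \<le> w" using w by simp
    note rest = card_rest[OF p(1) w1 w(2)]
    have ext: "spine_tail n w E' P (q @ [z])" "length (q @ [z]) = Suc (Suc i)"
      if "rotation E p q" "z \<in> rest n P - set p" "{last q, z} \<in> E'" "E \<subseteq> E'" for q z E'
      using that rotation_path[OF that(1) p(3)] spine_tail_mono[OF tail that(4)] len p(5)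
      by (auto simp: spine_tail_def is_path_def hd_append path_edges_append)
    \<comment> \<open>An available extension would mean that the next level is already reached; this
      supplies the maximality that \<open>posa\<close> asks for.\<close>
    have max: "{last q, z} \<notin> E" if "rotation E p q" "z \<in> rest n P - set p" for q z
      using ext[OF that] nex unfolding R_def by blast
    let ?X = "(\<lambda>(y, z). {y, z}) ` (endpoints E p \<times> (rest n P - set p))"
    note ends = card_endpoints[OF tail w1 w(2) max]
    have "card (rest n P - set p) = w - 1 - i"
      using p len rest by (simp add: card_Diff_subset is_path_def distinct_card)
    then have "card (endpoints E p \<times> (rest n P - set p)) = card (endpoints E p) * (w - 1 - i)"
      by (simp add: card_cartesian_product)
    moreover have "inj_on (\<lambda>(y, z). {y, z}) (endpoints E p \<times> (rest n P - set p))"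
      using ends(2) by (auto simp: inj_on_def doubleton_eq_iff)
    ultimately have "card ?X = card (endpoints E p) * (w - 1 - i)" by (simp add: card_image)
    moreover have "?X \<subseteq> {e \<in> all_edges n. R (Suc i) (insert e E)}"
    proof clarify
      fix y z assume y: "y \<in> endpoints E p" and z: "z \<in> rest n P" "z \<notin> set p"
      obtain q where q: "rotation E p q" "y = last q" using y by (auto simp: endpoints_def)
      have "{y, z} \<in> all_edges n"
        using y z ends(2) p(4) rest by (auto simp: all_edges_def card_insert_if)
      moreover have "R (Suc i) (insert {y, z} E)"
        unfolding R_def using ext[OF q(1), of z "insert {y, z} E"] q z by blast
      ultimately show "{y, z} \<in> all_edges n \<and> R (Suc i) (insert {y, z} E)" by blast
    qed
    ultimately have "card (endpoints E p) * (w - 1 - i)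
      \<le> card {e \<in> all_edges n. R (Suc i) (insert e E)}"
      using card_mono[of "{e \<in> all_edges n. R (Suc i) (insert e E)}" ?X]
      by (simp add: finite_all_edges)
    then have "real (card (endpoints E p)) * real (w - 1 - i)
      \<le> card {e \<in> all_edges n. R (Suc i) (insert e E)}"
      unfolding of_nat_mult[symmetric] by (rule of_nat_mono)
    moreover have "real w / 12 * real (w - 1 - i) \<le> real (card (endpoints E p)) * real (w - 1 - i)"
      using ends(1) by (intro mult_right_mono) auto
    ultimately show ?thesis by linarith
  qed
  have "(\<Sum>i<w - 1. 1 / (real w / 12 * real (w - 1 - i))) = 12 / w * (\<Sum>i<w - 1. 1 / real (w - 1 - i))"
    by (simp add: sum_distrib_left)
  also have "\<dots> \<le> 12 / w * (1 + ln (real (w - 1)))"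
    using w by (intro mult_left_mono sum_inverse_rev_le_ln) auto
  also have "\<dots> \<le> 12 / w * (1 + ln w)"
    using w by (intro mult_left_mono) auto
  finally have cost: "(\<Sum>i<w - 1. 1 / (real w / 12 * real (w - 1 - i))) \<le> 12 / w * (1 + ln w)" .
  have "R 0 E" if "expander_spine n w E" for E
  proof -
    obtain P where "spine n w E P" "expanding E (rest n P)"
      using \<open>expander_spine n w E\<close> unfolding expander_spine_def by blast
    then have "spine_tail n w E P [last P]" by (simp add: spine_tail_def is_path_def rest_def)
    then show ?thesis unfolding R_def by force
  qed
  moreover have "R i E'" if "E \<subseteq> E'" "R i E" for i E E'
    using that spine_tail_mono unfolding R_def by blast
  ultimately have "route n (expander_spine n w) (R (w - 1)) (w - 1) (12 / w * (1 + ln w))"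
    using boost cost w by (intro routeI[where R = R and g = "\<lambda>i. w / 12 * real (w - 1 - i)"]) simp_all
  then show ?thesis using w unfolding R_def by simp
qed

lemma hamiltonian_close:
  assumes "is_path E p" "length p = n" "set p = {..<n}" "3 \<le> n" "{last p, hd p} \<in> E"
  shows "hamiltonian n E"
proof -
  have "{p ! i, p ! (Suc i mod n)} \<in> E" if "i < n" for i
  proof (cases "Suc i < n")
    case True
    then show ?thesis using path_edges_nth[of i p] assms(1,2) by (auto simp: is_path_def)
  next
    case False
    then have "Suc i = n" using that by simp
    moreover have "p \<noteq> []" using assms(2,4) by auto
    ultimately have "p ! i = last p" "p ! (Suc i mod n) = hd p"
      using assms(2) by (auto simp: last_conv_nth hd_conv_nth)
    then show ?thesis using assms(5) by simp
  qed
  then show ?thesis using assms(1-4) unfolding hamiltonian_def is_hamilton_cycle_def is_path_def by blast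
qed

lemma hamiltonian_mono: "hamiltonian n E \<Longrightarrow> E \<subseteq> E' \<Longrightarrow> hamiltonian n E'"
  unfolding hamiltonian_def is_hamilton_cycle_def by blast

text \<open>The tail now covers \<open>rest n P\<close>, so joining any of its ends to the first
  vertex of the spine closes a Hamilton cycle.\<close>

lemma route_close:
  assumes w: "2 \<le> w" "w < n" "3 \<le> n"
  shows "route n (\<lambda>E. \<exists>P p. spine_tail n w E P p \<and> length p = w) (hamiltonian n) 1 (12 / w)"
proof -
  define T where "T E \<longleftrightarrow> (\<exists>P p. spine_tail n w E P p \<and> length p = w)" for E
  have boost: "real w / 12 \<le> card {e \<in> all_edges n. hamiltonian n (insert e E)}"
    if T: "T E" for E
  proof -
    obtain P p where tail: "spine_tail n w E P p" and len: "length p = w"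
      using T unfolding T_def by blast
    have p: "spine n w E P" "is_path E p" "set p \<subseteq> rest n P" "p \<noteq> []" "hd p = last P"
      using tail by (auto simp: spine_tail_def)
    have w1: "1 \<le> w" "w \<le> n" using w by simp_all
    note rest = card_rest[OF p(1) w1]
    have setp: "set p = rest n P"
      using p len rest by (metis card_subset_eq distinct_card finite_rest is_path_def)
    have P: "is_path E P" "length P = n + 1 - w" "set P \<subseteq> {..<n}" "P \<noteq> []"
      using p(1) w by (auto simp: spine_def)
    obtain y P' where PP: "P = y # P'" using P by (cases P) auto
    \<comment> \<open>As \<open>w < n\<close>, the spine has at least two vertices, and its first
      vertex differs from its last.\<close>
    have y: "y \<notin> rest n P"
      using P w PP by (auto simp: rest_def is_path_def)
    have "y < n" using P PP by auto
    have ham: "hamiltonian n (insert {last q, y} E)" if q: "rotation E p q" for q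
    proof (rule hamiltonian_close[of _ "P @ tl q"])
      let ?E = "insert {last q, y} E"
      have q': "is_path E q" "set q = set p" "hd q = hd p" "length q = w"
        using rotation_path[OF q p(2)] len by auto
      then obtain x r where r: "q = x # r" "x = last P" "r \<noteq> []"
        using w(1) p(5) by (cases q) fastforce+
      have dr: "x \<notin> set r" "is_path E r" "{x, hd r} \<in> E"
        using q' r by (auto simp: is_path_def path_edges_Cons)
      have setr: "set r = {..<n} - set P"
      proof -
        have "set r = rest n P - {x}" using q'(2) setp r dr(1) by auto
        then show ?thesis using r(2) last_in_set[OF P(4)] unfolding rest_def by blast
      qed
      have "is_path E (P @ tl q)"
        using P dr r setr by (auto simp: is_path_append)
      then show "is_path ?E (P @ tl q)" by (rule is_path_mono) auto
      show "length (P @ tl q) = n" using P q' w by simp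
      show "set (P @ tl q) = {..<n}" using setr r P by auto
      show "{last (P @ tl q), hd (P @ tl q)} \<in> insert {last q, y} E" using r PP by simp
    qed fact
    have "(\<lambda>z. {z, y}) ` endpoints E p \<subseteq> {e \<in> all_edges n. hamiltonian n (insert e E)}"
    proof clarify
      fix z assume z: "z \<in> endpoints E p"
      then obtain q where q: "rotation E p q" "z = last q" by (auto simp: endpoints_def)
      have "z \<in> set p" using z endpoints_subset[OF p(2,4)] by blast
      then have "{z, y} \<in> all_edges n"
        using setp y rest \<open>y < n\<close> by (auto simp: all_edges_def card_insert_if)
      then show "{z, y} \<in> all_edges n \<and> hamiltonian n (insert {z, y} E)" using ham q by blast
    qed
    then have "card ((\<lambda>z. {z, y}) ` endpoints E p) \<le> card {e \<in> all_edges n. hamiltonian n (insert e E)}"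
      by (intro card_mono) (auto simp: finite_all_edges)
    moreover have "inj_on (\<lambda>z. {z, y}) (endpoints E p)" by (auto simp: inj_on_def doubleton_eq_iff)
    ultimately have "card (endpoints E p) \<le> card {e \<in> all_edges n. hamiltonian n (insert e E)}"
      by (simp add: card_image)
    \<comment> \<open>Maximality is vacuous here: no vertex of \<open>rest n P\<close> is left
      outside \<open>p\<close>.\<close>
    moreover have "real w / 12 \<le> card (endpoints E p)"
      using setp by (intro card_endpoints(1)[OF tail w1]) auto
    ultimately show ?thesis by linarith
  qed
  have T_mono: "T E'" if "T E" "E \<subseteq> E'" for E E'
    using that spine_tail_mono unfolding T_def by blast
  define R where "R i = (if i = (0::nat) then T else hamiltonian n)" for i
  have R: "R 0 = T" "R 1 = hamiltonian n" by (simp_all add: R_def)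
  have "route n T (hamiltonian n) 1 (12 / w)"
  proof (rule routeI[where R = R and g = "\<lambda>_. w / 12"])
    show "R i E'" if "E \<subseteq> E'" "R i E" for i E E'
      using that T_mono hamiltonian_mono by (cases "i = 0") (auto simp: R_def)
    show "real w / 12 \<le> card {e \<in> all_edges n. R (Suc i) (insert e E)}"
      if "i < 1" "E \<subseteq> all_edges n" "R i E" for i E
      using that boost[of E] by (simp add: R_def)
  qed (use w R in simp_all)
  then show ?thesis unfolding T_def .
qed

section \<open>Joining paths\<close>

lemma card_le_twice_card_unordered:
  fixes X :: "('a \<times> 'a) set"
  assumes "finite X"
  shows "card X \<le> 2 * card ((\<lambda>(u, v). {u, v}) ` X)"
proof -
  let ?f = "\<lambda>(u, v). {u, v} :: 'a set"
  let ?fib = "\<lambda>e. {x \<in> X. ?f x = e}"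
  have fib: "card (?fib e) \<le> 2" if e: "e \<in> ?f ` X" for e
  proof -
    obtain x where x: "e = ?f x" using e by blast
    obtain u v where uv: "x = (u, v)" by (rule prod.exhaust)
    have "?fib e \<subseteq> {(u, v), (v, u)}"
    proof
      fix y assume "y \<in> ?fib e"
      moreover obtain u' v' where y: "y = (u', v')" by (rule prod.exhaust)
      ultimately have "{u', v'} = {u, v}" using x uv by simp
      then show "y \<in> {(u, v), (v, u)}" unfolding y doubleton_eq_iff by blast
    qed
    then have "card (?fib e) \<le> card {(u, v), (v, u)}" by (intro card_mono) auto
    also have "\<dots> \<le> 2" by (rule card_insert_le_m1) simp_all
    finally show ?thesis .
  qed
  have "X = (\<Union>e\<in>?f ` X. ?fib e)" by blast
  then have "card X = card (\<Union>e\<in>?f ` X. ?fib e)" by simp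
  also have "\<dots> \<le> (\<Sum>e\<in>?f ` X. card (?fib e))" using assms by (intro card_UN_le) auto
  also have "\<dots> \<le> (\<Sum>e\<in>?f ` X. 2)" using fib by (intro sum_mono) auto
  finally show ?thesis by simp
qed

definition linear_forest :: "nat \<Rightarrow> edge set \<Rightarrow> nat list set \<Rightarrow> bool" where
  "linear_forest n E F \<longleftrightarrow> finite F \<and> [] \<notin> F \<and> (\<forall>p\<in>F. is_path E p \<and> set p \<subseteq> {..<n}) \<and>
     (\<forall>p\<in>F. \<forall>q\<in>F. p \<noteq> q \<longrightarrow> set p \<inter> set q = {})"

text \<open>The harmonic sum is the allowance for vertices given up on the way from \<open>n\<close>
  paths to \<open>r\<close>: the step that starts with \<open>k\<close> paths may lose
  \<open>2 * a / k\<close> of them.\<close>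

definition covered :: "nat \<Rightarrow> real \<Rightarrow> nat \<Rightarrow> edge set \<Rightarrow> bool" where
  "covered n a r E \<longleftrightarrow> (\<exists>F. linear_forest n E F \<and> card F = r \<and>
     real n - 2 * a * (\<Sum>k=Suc r..n. 1 / real k) \<le> real (\<Sum>p\<in>F. length p))"

lemma covered_mono: "covered n a r E \<Longrightarrow> E \<subseteq> E' \<Longrightarrow> covered n a r E'"
proof -
  assume "covered n a r E" "E \<subseteq> E'"
  moreover have "linear_forest n E' F" if "linear_forest n E F" for F
    using that is_path_mono[OF _ \<open>E \<subseteq> E'\<close>] unfolding linear_forest_def by simp
  ultimately show ?thesis unfolding covered_def by blast
qed

lemma covered_singletons: "covered n a n E"
  unfolding covered_def
proof (intro exI conjI)
  have inj: "inj_on (\<lambda>v. [v]) {..<n}" by (auto simp: inj_on_def)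
  show "linear_forest n E ((\<lambda>v. [v]) ` {..<n})" by (auto simp: linear_forest_def is_path_def)
  show "card ((\<lambda>v. [v]) ` {..<n}) = n" using inj by (simp add: card_image)
  show "real n - 2 * a * (\<Sum>k=Suc n..n. 1 / real k) \<le> real (\<Sum>p\<in>(\<lambda>v. [v]) ` {..<n}. length p)"
    using inj by (simp add: sum.reindex)
qed

text \<open>Reversing the remainder of \<open>p\<close> puts \<open>p ! i\<close> next to
  \<open>q ! j\<close>; only the \<open>i\<close> and \<open>j\<close> vertices before them are
  lost.\<close>

lemma linear_forest_join:
  assumes F: "linear_forest n E F" and pq: "p \<in> F" "q \<in> F" "p \<noteq> q"
    and ab: "i < length p" "j < length q" and E': "{p ! i, q ! j} \<in> E'" "E \<subseteq> E'"
  defines "F' \<equiv> insert (rev (drop i p) @ drop j q) (F - {p, q})"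
  shows "linear_forest n E' F'" "card F' = card F - 1"
    "(\<Sum>p\<in>F. length p) \<le> (\<Sum>p\<in>F'. length p) + i + j"
proof -
  let ?r = "rev (drop i p) @ drop j q"
  have finF: "finite F" using F by (simp add: linear_forest_def)
  have path: "is_path E s" "set s \<subseteq> {..<n}" if "s \<in> F" for s
    using F that by (auto simp: linear_forest_def)
  have disj: "set s \<inter> set s' = {}" if "s \<in> F" "s' \<in> F" "s \<noteq> s'" for s s'
    using F that by (auto simp: linear_forest_def)
  have dp: "is_path E (drop i p)" "is_path E (drop j q)"
    using path[OF pq(1)] path[OF pq(2)]
      is_path_append[of E "take i p" "drop i p"] is_path_append[of E "take j q" "drop j q"] by auto
  have sub: "set (drop i p) \<subseteq> set p" "set (drop j q) \<subseteq> set q" by (auto dest: in_set_dropD)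
  have hd: "hd (drop i p) = p ! i" "hd (drop j q) = q ! j" using ab by (simp_all add: hd_drop_conv_nth)
  have "is_path E' ?r"
    using dp sub disj[OF pq] hd E' ab
    by (auto simp: is_path_def path_edges_append last_rev disjoint_iff)
  moreover have setr: "set ?r \<subseteq> set p \<union> set q" using sub by auto
  moreover have "?r \<noteq> []" using ab by simp
  moreover have dr: "set ?r \<inter> set s = {}" if "s \<in> F - {p, q}" for s
    using that setr disj[of s p] disj[of s q] pq by blast
  ultimately show "linear_forest n E' F'"
    using F E'(2) path[OF pq(1)] path[OF pq(2)] unfolding linear_forest_def F'_def
    by (auto intro: is_path_mono) 
  have notin: "?r \<notin> F - {p, q}"
  proof
    assume "?r \<in> F - {p, q}"
    from dr[OF this] show False using \<open>?r \<noteq> []\<close> by auto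
  qed
  have c: "card (F - {p, q}) = card F - 2" using pq finF by (simp add: card_Diff_subset)
  have "card F \<ge> 2" using pq finF card_mono[of F "{p, q}"] by simp
  then show "card F' = card F - 1" unfolding F'_def using notin finF c by simp
  have "(\<Sum>p\<in>F. length p) = (\<Sum>s\<in>F - {p, q}. length s) + (\<Sum>s\<in>{p, q}. length s)"
    using pq finF by (intro sum.subset_diff) auto
  moreover have "(\<Sum>p\<in>F'. length p) = (length p - i + (length q - j)) + (\<Sum>s\<in>F - {p, q}. length s)"
    unfolding F'_def using notin finF by simp
  ultimately show "(\<Sum>p\<in>F. length p) \<le> (\<Sum>p\<in>F'. length p) + i + j" using pq ab by simp
qed

text \<open>Two distinct paths may be joined at any of their first \<open>t\<close> vertices, which
  gives \<open>r * (r - 1) * t * t\<close> ordered pairs and at least half as many edges. Since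
  \<open>r * t\<close> is at least both \<open>r\<close> and \<open>a\<close>, this is of order
  \<open>(r + a)^2\<close> even for small \<open>r\<close>.\<close>

lemma card_join_boosters:
  assumes a: "a \<ge> 0" and r: "2 \<le> r" "r \<le> n"
    and cov: "covered n a r E" and ncov: "\<not> covered n a (r - 1) E"
  shows "(real r + a)\<^sup>2 / 16 \<le> card {e \<in> all_edges n. covered n a (r - 1) (insert e E)}"
proof -
  obtain F where F: "linear_forest n E F" and cF: "card F = r"
    and len: "real n - 2 * a * (\<Sum>k=Suc r..n. 1 / real k) \<le> real (\<Sum>p\<in>F. length p)"
    using cov unfolding covered_def by blast
  have finF: "finite F" using F by (simp add: linear_forest_def)
  \<comment> \<open>The largest number of joining positions with index at most \<open>a / r\<close>,
    so that a join loses at most \<open>2 * a / r\<close> vertices.\<close>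
  define t where "t = Suc (nat \<lfloor>a / r\<rfloor>)"
  have t: "real t - 1 \<le> a / r" "a / r \<le> real t" 
    unfolding t_def using a real_of_int_floor_add_one_ge[of "a / r"] by (auto simp: add.commute)
  have "(\<Sum>k=r..n. 1 / real k) = 1 / r + (\<Sum>k=Suc r..n. 1 / real k)"
    using r by (simp add: sum.atLeast_Suc_atMost)
  then have sumr: "2 * a * (\<Sum>k=Suc (r - 1)..n. 1 / real k) = 2 * (a / r) + 2 * a * (\<Sum>k=Suc r..n. 1 / real k)"
    using r by (simp add: algebra_simps)
  \<comment> \<open>A path shorter than \<open>t\<close> could be discarded entirely within the
    allowance, and \<open>r - 1\<close> paths would be reached without any new edge.\<close>
  have long: "t \<le> length p" if p: "p \<in> F" for p
  proof (rule ccontr)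
    assume "\<not> t \<le> length p"
    then have "real (length p) \<le> a / r" using t by linarith
    moreover have "0 \<le> a / r" using a by simp
    moreover have "real (\<Sum>p\<in>F. length p) = length p + real (\<Sum>p\<in>F - {p}. length p)"
      using finF p by (simp add: sum.remove)
    ultimately have "real n - 2 * a * (\<Sum>k=Suc (r - 1)..n. 1 / real k) \<le> real (\<Sum>p\<in>F - {p}. length p)"
      using len unfolding sumr by linarith
    moreover have "linear_forest n E (F - {p})" using F by (auto simp: linear_forest_def)
    moreover have "card (F - {p}) = r - 1" using p cF finF by simp
    ultimately show False using ncov unfolding covered_def by blast
  qed
  define I where "I = (SIGMA p:F. F - {p})"
  define H where "H p = set (take t p)" for p :: "nat list"
  define X where "X = (\<Union>(p, q)\<in>I. H p \<times> H q)"
  have HF: "H p \<subseteq> set p" for p by (auto simp: H_def dest: in_set_takeD)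
  have dist: "distinct p" if "p \<in> F" for p using F that by (auto simp: linear_forest_def is_path_def)
  have cH: "card (H p) = t" if "p \<in> F" for p
    using dist[OF that] long[OF that] by (simp add: H_def distinct_card)
  have disj: "p = p'" if "p \<in> F" "p' \<in> F" "u \<in> H p" "u \<in> H p'" for p p' u
    using F that HF[of p] HF[of p'] unfolding linear_forest_def by blast
  have finI: "finite I" using finF by (simp add: I_def)
  have cI: "card I = r * (r - 1)" using finF cF by (simp add: I_def)
  have "card X = (\<Sum>x\<in>I. card ((\<lambda>(p, q). H p \<times> H q) x))"
    unfolding X_def by (rule card_UN_disjoint[OF finI])
      (auto simp: I_def H_def[symmetric] dest: disj, simp_all add: H_def)
  also have "\<dots> = (\<Sum>x\<in>I. t * t)"
    by (rule sum.cong) (auto simp: I_def card_cartesian_product cH)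
  finally have cX: "card X = r * (r - 1) * (t * t)" using cI by simp
  have finX: "finite X" unfolding X_def using finI by (auto simp: H_def)
  let ?B = "{e \<in> all_edges n. covered n a (r - 1) (insert e E)}"
  have "(\<lambda>(u, v). {u, v}) ` X \<subseteq> ?B"
  proof clarify
    fix u v assume "(u, v) \<in> X"
    then obtain p q where pq: "p \<in> F" "q \<in> F" "p \<noteq> q" and uv: "u \<in> H p" "v \<in> H q"
      by (auto simp: X_def I_def)
    obtain i j where ij: "i < length p" "j < length q" "i < t" "j < t" "u = p ! i" "v = q ! j"
      using uv unfolding H_def in_set_conv_nth by (auto simp: nth_take)
    have "u \<noteq> v" using disj[OF pq(1,2)] uv pq(3) by blast
    moreover have "u < n" "v < n" using F pq uv HF by (auto simp: linear_forest_def)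
    ultimately have edge: "{u, v} \<in> all_edges n" by (auto simp: all_edges_def card_insert_if)
    let ?E = "insert {u, v} E" and ?F = "insert (rev (drop i p) @ drop j q) (F - {p, q})"
    have "{p ! i, q ! j} \<in> ?E" "E \<subseteq> ?E" using ij by auto
    note join = linear_forest_join[OF F pq ij(1,2) this]
    have "real i \<le> a / r" "real j \<le> a / r" using ij t by linarith+
    moreover have "real (\<Sum>p\<in>F. length p) \<le> real (\<Sum>p\<in>?F. length p) + i + j"
      using join(3) by linarith
    ultimately have "real n - 2 * a * (\<Sum>k=Suc (r - 1)..n. 1 / real k) \<le> real (\<Sum>p\<in>?F. length p)"
      using len unfolding sumr by linarith
    then have "covered n a (r - 1) ?E" unfolding covered_def using join(1,2) cF by blast
    then show "{u, v} \<in> all_edges n \<and> covered n a (r - 1) ?E" using edge by blast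
  qed
  then have "card ((\<lambda>(u, v). {u, v}) ` X) \<le> card ?B"
    by (intro card_mono) (auto simp: finite_all_edges)
  then have "card X \<le> 2 * card ?B" using card_le_twice_card_unordered[OF finX] by linarith
  then have "real (r * (r - 1) * (t * t)) \<le> real (2 * card ?B)" unfolding cX by (rule of_nat_mono)
  then have 1: "real r * real (r - 1) * (real t * real t) \<le> 2 * real (card ?B)" by simp
  have "real r + a \<le> 2 * (real r * real t)"
  proof -
    have "real r * 1 \<le> real r * real t" by (intro mult_left_mono) (auto simp: t_def)
    moreover have "a \<le> real r * real t" using t(2) r by (simp add: field_simps)
    ultimately show ?thesis by linarith
  qed
  then have "(real r + a)\<^sup>2 \<le> (2 * (real r * real t))\<^sup>2" using a by (intro power_mono) auto
  also have "\<dots> = 8 * (real r * (real r / 2) * (real t * real t))" by (simp add: power2_eq_square)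
  also have "\<dots> \<le> 8 * (real r * real (r - 1) * (real t * real t))"
    using r by (intro mult_left_mono mult_right_mono) auto
  finally show ?thesis using 1 by simp
qed

text \<open>The sum telescopes by \<open>1 / x^2 \<le> 1 / (x - 1) - 1 / x\<close>. It yields a
  joining cost of order \<open>1 / a\<close>.\<close>

lemma sum_inverse_squares_le:
  fixes a :: real
  assumes "a > 0" "m \<le> n - 1" "n \<ge> 1"
  shows "(\<Sum>i<m. 1 / (real (n - i) + a)\<^sup>2) \<le> 1 / (real (n - m) + a)"
  using assms(2)
proof (induction m)
  case 0
  then show ?case using assms by simp
next
  case (Suc m)
  define x where "x = real (n - m) + a"
  have x: "x > 1" "real (n - Suc m) + a = x - 1" using Suc.prems assms by (auto simp: x_def of_nat_diff)
  have "1 / x + 1 / x\<^sup>2 \<le> 1 / (x - 1)"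
    using x(1) by (simp add: field_simps power2_eq_square)
  moreover have "(\<Sum>i<m. 1 / (real (n - i) + a)\<^sup>2) \<le> 1 / x"
    using Suc.IH Suc.prems unfolding x_def by linarith
  ultimately show ?case unfolding sum.lessThan_Suc x(2) x_def[symmetric] by linarith
qed

lemma route_spine:
  assumes a: "a > 0" and n: "n \<ge> 1" and w: "1 + 2 * a * (1 + ln n) \<le> w" "w \<le> n"
  shows "route n (\<lambda>E. True) (\<lambda>E. \<exists>P. spine n w E P) (n - 1) (16 / a)"
proof (rule routeI[where R = "\<lambda>i. covered n a (n - i)" and g = "\<lambda>i. (real (n - i) + a)\<^sup>2 / 16"])
  show "covered n a (n - 0) E" for E using covered_singletons by simp
  show "\<exists>P. spine n w E P" if "covered n a (n - (n - 1)) E" for E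
  proof -
    have one: "n - (n - 1) = 1" using n by simp
    obtain F where F: "linear_forest n E F" "card F = 1"
      and len: "real n - 2 * a * (\<Sum>k=Suc 1..n. 1 / real k) \<le> real (\<Sum>p\<in>F. length p)"
      using \<open>covered n a (n - (n - 1)) E\<close> unfolding covered_def one by blast
    obtain p where p: "F = {p}" using F(2) by (auto simp: card_1_singleton_iff)
    have "(\<Sum>k=Suc 1..n. 1 / real k) \<le> (\<Sum>k=1..n. 1 / real k)" by (rule sum_mono2) auto
    also have "\<dots> \<le> 1 + ln n" by (rule sum_inverse_le_ln[OF n])
    finally have "2 * a * (\<Sum>k=Suc 1..n. 1 / real k) \<le> 2 * a * (1 + ln n)"
      using a by (intro mult_left_mono) auto
    \<comment> \<open>The summand 1 in the lower bound on \<open>w\<close> pays for the vertex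
      shared by the spine and the rest. The surplus of the path is cut off below.\<close>
    then have "n + 1 - w \<le> length p" using len w p by simp
    moreover have "is_path E (take (n + 1 - w) p)"
      using F p is_path_append[of E "take (n + 1 - w) p" "drop (n + 1 - w) p"]
      by (auto simp: linear_forest_def)
    ultimately have "spine n w E (take (n + 1 - w) p)"
      using F p by (auto simp: spine_def linear_forest_def dest: in_set_takeD)
    then show ?thesis ..
  qed
  show "covered n a (n - i) E'" if "E \<subseteq> E'" "covered n a (n - i) E" for i E E'
    using that covered_mono by blast
  show "(real (n - i) + a)\<^sup>2 / 16 \<le> card {e \<in> all_edges n. covered n a (n - Suc i) (insert e E)}"
    if "i < n - 1" "E \<subseteq> all_edges n" "covered n a (n - i) E" "\<not> covered n a (n - Suc i) E" for i E
    using card_join_boosters[of a "n - i" n E] that a by simp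
  have "(\<Sum>i<n - 1. 1 / ((real (n - i) + a)\<^sup>2 / 16)) = 16 * (\<Sum>i<n - 1. 1 / (real (n - i) + a)\<^sup>2)"
    by (simp add: sum_distrib_left)
  also have "\<dots> \<le> 16 * (1 / (real (n - (n - 1)) + a))"
    by (intro mult_left_mono sum_inverse_squares_le a n) auto
  also have "\<dots> \<le> 16 * (1 / a)" using a by (intro mult_left_mono frac_le) auto
  finally show "(\<Sum>i<n - 1. 1 / ((real (n - i) + a)\<^sup>2 / 16)) \<le> 16 / a" by simp
  show "0 < (real (n - i) + a)\<^sup>2 / 16" for i using a by (simp add: add_nonneg_pos)
qed

section \<open>Building an expander\<close>

text \<open>A single term of the binomial expansion of \<open>(1 + x) ^ w\<close> at
  \<open>x = k / w\<close> is at most \<open>exp (x * w) = exp k\<close>, and \<open>exp 1\<close>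
  is at most 3.\<close>

lemma binomial_le_power:
  assumes "0 < k" "0 < w"
  shows "real (w choose k) \<le> (3 * real w / real k) ^ k"
proof -
  define x where "x = real k / real w"
  have x: "x > 0" using assms by (simp add: x_def)
  have "real (w choose k) * x ^ k \<le> (x + 1) ^ w"
  proof (cases "k \<le> w")
    case True
    have "real (w choose k) * x ^ k * 1 ^ (w - k) \<le> (\<Sum>i\<le>w. real (w choose i) * x ^ i * 1 ^ (w - i))"
      using True x by (intro member_le_sum[of k "{..w}" "\<lambda>i. real (w choose i) * x ^ i * 1 ^ (w - i)"]) auto
    then show ?thesis unfolding binomial_ring[of x 1 w] by simp
  next
    case False
    then show ?thesis using x by (simp add: binomial_eq_0)
  qed
  also have "\<dots> \<le> exp x ^ w" using x by (intro power_mono) (auto simp: add.commute)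
  also have "\<dots> = exp 1 ^ k"
    using assms by (simp add: exp_of_nat_mult[symmetric] x_def)
  also have "\<dots> \<le> 3 ^ k" using exp_le by (intro power_mono) auto
  finally have "real (w choose k) \<le> 3 ^ k / x ^ k" using x by (simp add: field_simps)
  also have "\<dots> = (3 * real w / real k) ^ k" by (simp add: x_def power_divide power_mult_distrib)
  finally show ?thesis .
qed

text \<open>The certificates of failed expansion: if \<open>S\<close> has at most
  \<open>2 * card S\<close> neighbours, then these together with \<open>S\<close> fit into a set
  \<open>Z\<close> of size \<open>3 * card S\<close> that contains all choices of
  \<open>S\<close>.\<close>

definition bad_pairs :: "nat set \<Rightarrow> (nat set \<times> nat set) set" where
  "bad_pairs W = {(S, Z). S \<subseteq> W \<and> Z \<subseteq> W \<and> S \<noteq> {} \<and> 12 * card S \<le> card W \<and> card Z = 3 * card S}"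

definition weight :: "nat set \<Rightarrow> (nat \<times> nat) set \<Rightarrow> nat set \<times> nat set \<Rightarrow> real" where
  "weight W F = (\<lambda>(S, Z). if F `` S \<subseteq> Z
     then (6 * card S / card W) ^ (20 * card S - card (F \<inter> S \<times> UNIV)) else 0)"

text \<open>
  If every vertex of \<open>W\<close> chooses \<open>20\<close> random out-neighbours, twice the probability that a given
  choice falls into \<open>Z\<close> is \<open>6 * card S / card W\<close>.  The potential of the choices \<open>F\<close> made so far thus
  bounds the expected number of pairs \<open>(S, Z)\<close> for which all choices of \<open>S\<close> end up in \<open>Z\<close>, with a
  factor \<open>2\<close> to spare for each choice.
\<close>

definition potential :: "nat set \<Rightarrow> (nat \<times> nat) set \<Rightarrow> real" where
  "potential W F = (\<Sum>b\<in>bad_pairs W. weight W F b)"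

lemma finite_bad_pairs: "finite W \<Longrightarrow> finite (bad_pairs W)"
  unfolding bad_pairs_def by (rule finite_subset[of _ "Pow W \<times> Pow W"]) auto

lemma weight_nonneg: "weight W F b \<ge> 0"
  by (auto simp: weight_def split: prod.splits)

text \<open>The two binomial coefficients contribute about \<open>x ^ (-4)\<close> per element of
  \<open>S\<close>, against \<open>x ^ 20\<close> from the 20 choices. What remains is
  \<open>3888 * x ^ 16\<close> with \<open>3888 = 18 * 6^3\<close>, and \<open>x \<le> 1 / 2\<close>
  because \<open>S\<close> has at most \<open>w / 12\<close> elements.\<close>

lemma potential_term_le:
  assumes s: "1 \<le> s" "12 * s \<le> w"
  shows "real (w choose s) * (real (w choose (3 * s)) * (6 * s / w) ^ (20 * s)) \<le> (1 / 2) ^ s"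
proof -
  define x where "x = 6 * real s / real w"
  have w: "w > 0" using s by simp
  have x: "0 < x" "x \<le> 1 / 2" using s w by (auto simp: x_def field_simps)
  have ws: "real w / real s = 6 / x" using s w by (simp add: x_def)
  have e: "3 * real w / real s = 3 * (6 / x)" "3 * real w / real (3 * s) = 6 / x"
    unfolding ws[symmetric] by simp_all
  have s0: "0 < s" "0 < 3 * s" using s by simp_all
  have "real (w choose s) \<le> (3 * (6 / x)) ^ s" "real (w choose (3 * s)) \<le> (6 / x) ^ (3 * s)"
    using binomial_le_power[OF s0(1) w] binomial_le_power[OF s0(2) w] unfolding e .
  moreover have "(6 / x) ^ (3 * s) = ((6 / x) ^ 3) ^ s" by (rule power_mult)
  ultimately have "real (w choose s) * (real (w choose (3 * s)) * x ^ (20 * s))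
      \<le> (3 * (6 / x)) ^ s * (((6 / x) ^ 3) ^ s * (x ^ 20) ^ s)"
    using x by (intro mult_mono) (auto simp: power_mult)
  also have "\<dots> = (3 * (6 / x) * ((6 / x) ^ 3 * x ^ 20)) ^ s" by (simp only: power_mult_distrib)
  also have "3 * (6 / x) * ((6 / x) ^ 3 * x ^ 20) = 3888 * x ^ 16"
    using x by (simp add: field_simps power_divide eval_nat_numeral)
  also have "(3888 * x ^ 16) ^ s \<le> (1 / 2) ^ s"
  proof (rule power_mono)
    have "x ^ 16 \<le> (1 / 2) ^ 16" using x by (intro power_mono) auto
    then show "3888 * x ^ 16 \<le> 1 / 2" by (simp add: power_divide)
  qed (use x in simp)
  finally show ?thesis by (simp add: x_def)
qed

text \<open>Without choices every bad pair has its full weight. Grouped by the size of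
  \<open>S\<close>, the weights are dominated by the geometric series of \<open>1 / 2\<close>, whose
  finite partial sums stay below 1.\<close>

lemma potential_empty:
  assumes W: "finite W"
  shows "potential W {} < 1"
proof -
  define w where "w = card W"
  define m where "m = w div 12"
  define \<S> where "\<S> = {S. S \<subseteq> W \<and> S \<noteq> {} \<and> 12 * card S \<le> w}"
  define h where "h s = real (w choose (3 * s)) * (6 * real s / w) ^ (20 * s)" for s :: nat
  have fin\<S>: "finite \<S>" unfolding \<S>_def using W by simp
  have "bad_pairs W = (SIGMA S:\<S>. {Z. Z \<subseteq> W \<and> card Z = 3 * card S})"
    by (auto simp: bad_pairs_def \<S>_def w_def)
  then have "potential W {} = (\<Sum>S\<in>\<S>. \<Sum>Z | Z \<subseteq> W \<and> card Z = 3 * card S. weight W {} (S, Z))"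
    unfolding potential_def using fin\<S> W by (simp add: sum.Sigma)
  also have "\<dots> = (\<Sum>S\<in>\<S>. h (card S))"
    by (rule sum.cong) (auto simp: weight_def h_def n_subsets[OF W] w_def)
  also have "\<dots> = (\<Sum>s=1..m. \<Sum>S | S \<in> \<S> \<and> card S = s. h (card S))"
  proof (rule sum.group[symmetric])
    show "card ` \<S> \<subseteq> {1..m}"
    proof
      fix s assume "s \<in> card ` \<S>"
      then obtain S where S: "S \<in> \<S>" "s = card S" by blast
      then have "finite S" "S \<noteq> {}" using W finite_subset by (auto simp: \<S>_def)
      then have "1 \<le> s" using S(2) card_gt_0_iff[of S] by simp
      then show "s \<in> {1..m}" using S by (auto simp: \<S>_def m_def)
    qed
  qed (use fin\<S> in auto)
  also have "\<dots> \<le> (\<Sum>s=1..m. (1 / 2) ^ s)"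
  proof (rule sum_mono)
    fix s assume s: "s \<in> {1..m}"
    have "{S. S \<in> \<S> \<and> card S = s} = {S. S \<subseteq> W \<and> card S = s}"
      using s by (auto simp: \<S>_def m_def)
    then have "card {S. S \<in> \<S> \<and> card S = s} = w choose s" by (simp add: n_subsets[OF W] w_def)
    then have "(\<Sum>S | S \<in> \<S> \<and> card S = s. h (card S)) = (w choose s) * h s" by simp
    also have "(w choose s) * h s \<le> (1 / 2) ^ s"
      unfolding h_def using s by (intro potential_term_le) (auto simp: m_def)
    finally show "(\<Sum>S | S \<in> \<S> \<and> card S = s. h (card S)) \<le> (1 / 2) ^ s" .
  qed
  also have "\<dots> = 1 - (1 / 2) ^ m" by (induction m) auto
  also have "\<dots> < 1" by simp
  finally show ?thesis .
qed

lemma card_choices: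
  assumes "finite F" "finite S"
  shows "card (F \<inter> S \<times> UNIV) = (\<Sum>u\<in>S. card (F `` {u}))"
proof -
  have "F \<inter> S \<times> UNIV = (SIGMA u:S. F `` {u})" by auto
  moreover have "finite (F `` {u})" for u using assms(1) by (rule finite_Image)
  ultimately show ?thesis using assms(2) by simp
qed

text \<open>A choice by a vertex of \<open>S\<close> either leaves \<open>Z\<close> and kills the
  pair, or uses up one of the outstanding factors \<open>6 * card S / card W\<close>.\<close>

lemma weight_insert:
  assumes F: "finite F" and new: "(v, z) \<notin> F" and deg: "\<forall>u\<in>W. card (F `` {u}) \<le> 20"
    and v: "card (F `` {v}) < 20" and W: "finite W" and b: "(S, Z) \<in> bad_pairs W"
  shows "weight W (insert (v, z) F) (S, Z) =
    (if v \<notin> S then weight W F (S, Z)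
     else if z \<in> Z then weight W F (S, Z) * (card W / (6 * card S)) else 0)"
proof (cases "v \<in> S")
  case False
  then have "insert (v, z) F `` S = F `` S" "insert (v, z) F \<inter> S \<times> UNIV = F \<inter> S \<times> UNIV" by auto
  then show ?thesis using False by (simp add: weight_def)
next
  case True
  have S: "S \<subseteq> W" "finite S" "card S > 0" "card W > 0"
    using b W finite_subset card_gt_0_iff[of S] by (auto simp: bad_pairs_def)
  define x where "x = 6 * real (card S) / real (card W)"
  have x: "x > 0" using S by (simp add: x_def)
  define c where "c = card (F \<inter> S \<times> UNIV)"
  have "c = (\<Sum>u\<in>S. card (F `` {u}))" unfolding c_def by (rule card_choices[OF F S(2)])
  \<comment> \<open>As \<open>v\<close> still lacks a choice, the exponent is positive and the
    truncated subtraction is a genuine one.\<close>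
  also have "\<dots> < (\<Sum>u\<in>S. 20)"
    using S deg v True by (intro sum_strict_mono_ex1) auto
  finally have c: "c < 20 * card S" by simp
  have "insert (v, z) F \<inter> S \<times> UNIV = insert (v, z) (F \<inter> S \<times> UNIV)" using True by auto
  moreover have "card (insert (v, z) (F \<inter> S \<times> UNIV)) = Suc c" using new F by (simp add: c_def)
  ultimately have c': "card (insert (v, z) F \<inter> S \<times> UNIV) = Suc c" by simp
  have im: "insert (v, z) F `` S = insert z (F `` S)" using True by auto
  have "20 * card S - c = Suc (20 * card S - Suc c)" using c by simp
  then have "x ^ (20 * card S - c) = x ^ (20 * card S - Suc c) * x" by simp
  then have "x ^ (20 * card S - Suc c) = x ^ (20 * card S - c) * (1 / x)" using x by simp
  moreover have "1 / x = card W / (6 * card S)" by (simp add: x_def)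
  ultimately have "x ^ (20 * card S - Suc c) = x ^ (20 * card S - c) * (card W / (6 * card S))" by simp
  then show ?thesis using True unfolding weight_def prod.case im c' c_def[symmetric] x_def by simp
qed

text \<open>Over all targets \<open>z\<close>, a pair with \<open>v\<close> in \<open>S\<close>
  keeps its weight times \<open>card W / (6 * card S)\<close> for the \<open>3 * card S\<close>
  elements of \<open>Z\<close>, on average half its weight. By Markov's inequality at most half of
  the targets increase the potential. Targets chosen before are counted as good here and are
  discarded in \<open>card_choice_boosters\<close>.\<close>

lemma card_good_choices:
  assumes F: "finite F" and deg: "\<forall>u\<in>W. card (F `` {u}) \<le> 20"
    and v: "card (F `` {v}) < 20" and W: "finite W"
  shows "card W \<le> 2 * card {z \<in> W. (v, z) \<notin> F \<longrightarrow> potential W (insert (v, z) F) \<le> potential W F}"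
proof -
  define Bv where "Bv = {b \<in> bad_pairs W. v \<in> fst b}"
  define Y where "Y = (\<Sum>b\<in>Bv. weight W F b)"
  define y where "y z b = (if z \<in> snd b then weight W F b * (card W / (6 * card (fst b))) else 0)" for z b
  define X where "X z = (\<Sum>b\<in>Bv. y z b)" for z
  have finB: "finite (bad_pairs W)" by (rule finite_bad_pairs[OF W])
  then have finBv: "finite Bv" by (simp add: Bv_def)
  have Y0: "Y \<ge> 0" unfolding Y_def by (intro sum_nonneg weight_nonneg)
  have X0: "X z \<ge> 0" for z unfolding X_def y_def by (intro sum_nonneg) (simp add: weight_nonneg)
  have split: "potential W F' = (\<Sum>b\<in>bad_pairs W - Bv. weight W F' b) + (\<Sum>b\<in>Bv. weight W F' b)" for F'
    unfolding potential_def using finB by (intro sum.subset_diff) (auto simp: Bv_def)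
  have step: "potential W (insert (v, z) F) = potential W F - Y + X z" if "(v, z) \<notin> F" for z
  proof -
    note wi = weight_insert[OF F that deg v W]
    have "(\<Sum>b\<in>bad_pairs W - Bv. weight W (insert (v, z) F) b) = (\<Sum>b\<in>bad_pairs W - Bv. weight W F b)"
      by (rule sum.cong) (auto simp: Bv_def wi)
    moreover have "(\<Sum>b\<in>Bv. weight W (insert (v, z) F) b) = X z"
      unfolding X_def y_def by (rule sum.cong) (auto simp: Bv_def wi)
    ultimately show ?thesis using split[of F] split[of "insert (v, z) F"] by (simp add: Y_def)
  qed
  have "(\<Sum>z\<in>W. X z) = (\<Sum>b\<in>Bv. \<Sum>z\<in>W. y z b)" unfolding X_def by (rule sum.swap)
  also have "\<dots> = (\<Sum>b\<in>Bv. card W / 2 * weight W F b)"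
  proof (rule sum.cong[OF HOL.refl])
    fix b assume "b \<in> Bv"
    then obtain S Z where b: "b = (S, Z)" "(S, Z) \<in> bad_pairs W" by (cases b) (auto simp: Bv_def)
    then have SZ: "Z \<subseteq> W" "card Z = 3 * card S" "card S > 0"
      using W finite_subset card_gt_0_iff[of S] by (auto simp: bad_pairs_def)
    have "(\<Sum>z\<in>W. y z b) = (\<Sum>z\<in>Z. weight W F b * (card W / (6 * card S)))"
      unfolding y_def b using W SZ(1) by (simp add: sum.If_cases Int_absorb1)
    also have "\<dots> = card W / 2 * weight W F b" using SZ by simp
    finally show "(\<Sum>z\<in>W. y z b) = card W / 2 * weight W F b" .
  qed
  also have "\<dots> = card W / 2 * Y" by (simp add: Y_def sum_distrib_left)
  finally have sumX: "(\<Sum>z\<in>W. X z) = card W / 2 * Y" .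
  define B where "B = {z \<in> W. X z > Y}"
  have "2 * card B \<le> card W"
  proof (rule ccontr)
    assume less: "\<not> 2 * card B \<le> card W"
    then have "B \<noteq> {}" by auto
    moreover have "finite B" using W by (simp add: B_def)
    ultimately have "(\<Sum>z\<in>B. Y) < (\<Sum>z\<in>B. X z)" by (intro sum_strict_mono) (auto simp: B_def)
    also have "\<dots> \<le> (\<Sum>z\<in>W. X z)" using W X0 by (intro sum_mono2) (auto simp: B_def)
    also have "\<dots> = card W / 2 * Y" by (rule sumX)
    also have "\<dots> \<le> card B * Y" using less Y0 by (intro mult_right_mono) auto
    finally show False by simp
  qed
  moreover have "W - B \<subseteq> {z \<in> W. (v, z) \<notin> F \<longrightarrow> potential W (insert (v, z) F) \<le> potential W F}"
    using step by (auto simp: B_def)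
  then have "card (W - B) \<le> card {z \<in> W. (v, z) \<notin> F \<longrightarrow> potential W (insert (v, z) F) \<le> potential W F}"
    using W by (intro card_mono) auto
  moreover have "card (W - B) = card W - card B"
    using W by (intro card_Diff_subset) (auto simp: B_def)
  ultimately show ?thesis by linarith
qed

section \<open>Choosing the edges of the expander one by one\<close>

definition choices :: "nat \<Rightarrow> nat \<Rightarrow> edge set \<Rightarrow> nat list \<Rightarrow> (nat \<times> nat) set \<Rightarrow> bool" where
  "choices n w E P F \<longleftrightarrow> spine n w E P \<and> F \<subseteq> rest n P \<times> rest n P \<and>
     (\<forall>(u, z)\<in>F. u \<noteq> z \<and> {u, z} \<in> E) \<and> (\<forall>u\<in>rest n P. card (F `` {u}) \<le> 20) \<and>
     potential (rest n P) F < 1"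

lemma choices_mono: "choices n w E P F \<Longrightarrow> E \<subseteq> E' \<Longrightarrow> choices n w E' P F"
  using is_path_mono[of E P E'] by (auto simp: choices_def spine_def)

lemma finite_choices: "choices n w E P F \<Longrightarrow> finite F"
  using finite_subset[of F "rest n P \<times> rest n P"] by (auto simp: choices_def)

text \<open>Once all choices are made no factor is outstanding, so a pair with all choices of
  \<open>S\<close> in \<open>Z\<close> weighs 1; a potential below 1 excludes such pairs, and hence
  sets that fail to expand.\<close>

lemma expander_spine_of_choices:
  assumes ch: "choices n w E P F" and full: "card F = 20 * w" and w: "1 \<le> w" "w \<le> n"
  shows "expander_spine n w E"
proof -
  let ?W = "rest n P"
  have P: "spine n w E P" and FW: "F \<subseteq> ?W \<times> ?W" and FE: "\<And>u z. (u, z) \<in> F \<Longrightarrow> u \<noteq> z \<and> {u, z} \<in> E"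
    and deg: "\<And>u. u \<in> ?W \<Longrightarrow> card (F `` {u}) \<le> 20" and pot: "potential ?W F < 1"
    using ch by (auto simp: choices_def)
  note rest = card_rest[OF P w]
  have finF: "finite F" by (rule finite_choices[OF ch])
  have "F \<inter> ?W \<times> UNIV = F" using FW by blast
  then have sumF: "(\<Sum>u\<in>?W. card (F `` {u})) = (\<Sum>u\<in>?W. 20)"
    using card_choices[OF finF, of ?W] full rest by simp
  \<comment> \<open>The total \<open>20 * w\<close> leaves no vertex below its maximum.\<close>
  have deg20: "card (F `` {u}) = 20" if "u \<in> ?W" for u
  proof (rule ccontr)
    assume "card (F `` {u}) \<noteq> 20"
    then have "card (F `` {u}) < 20" using deg[OF that] by simp
    then have "(\<Sum>u\<in>?W. card (F `` {u})) < (\<Sum>u\<in>?W. 20)"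
      using that deg by (intro sum_strict_mono_ex1) auto
    then show False using sumF by simp
  qed
  have "2 * card S < card (nbrs E ?W S)" if S: "S \<subseteq> ?W" "S \<noteq> {}" "12 * card S \<le> card ?W" for S
  proof (rule ccontr)
    assume small: "\<not> 2 * card S < card (nbrs E ?W S)"
    have finS: "finite S" using finite_subset[OF S(1)] by simp
    have sub: "F `` S \<subseteq> S \<union> nbrs E ?W S"
      using FW FE by (auto simp: nbrs_def)
    have "card (F `` S) \<le> card (S \<union> nbrs E ?W S)"
      using sub finS by (intro card_mono) (auto simp: nbrs_def)
    also have "\<dots> \<le> card S + card (nbrs E ?W S)" by (rule card_Un_le)
    finally have "card (F `` S) \<le> 3 * card S" using small by linarith
    moreover have "F `` S \<subseteq> ?W" using FW by blast
    moreover have "3 * card S \<le> card ?W" using S(3) by linarith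
    ultimately obtain Z where Z: "F `` S \<subseteq> Z" "Z \<subseteq> ?W" "card Z = 3 * card S"
      using exists_subset_between[of "F `` S" "3 * card S" ?W] by auto
    have b: "(S, Z) \<in> bad_pairs ?W" using S Z by (auto simp: bad_pairs_def)
    have "card (F \<inter> S \<times> UNIV) = (\<Sum>u\<in>S. 20)"
      unfolding card_choices[OF finF finS] using deg20 S(1) by (intro sum.cong) auto
    then have "weight ?W F (S, Z) = 1" using Z by (simp add: weight_def)
    then have "1 \<le> potential ?W F"
      unfolding potential_def
      using member_le_sum[OF b, of "weight ?W F"] weight_nonneg finite_bad_pairs by simp
    then show False using pot by simp
  qed
  then show ?thesis using P unfolding expander_spine_def expanding_def by blast
qed

text \<open>At least \<open>(20 * w - card F) / 20\<close> vertices lack a choice. Each has at least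
  \<open>w / 2\<close> good targets, of which itself and its at most 19 earlier choices are removed;
  \<open>w / 4\<close> remain as \<open>w \<ge> 80\<close>. Passing to unordered pairs costs another
  2, so the constant is \<open>20 * 4 * 2 = 160\<close>.\<close>

lemma card_choice_boosters:
  assumes w: "80 \<le> w" "w \<le> n" and ch: "choices n w E P F"
  shows "real (20 * w - card F) * w / 160 \<le>
    card {e \<in> all_edges n. \<exists>P F'. choices n w (insert e E) P F' \<and> card F' = Suc (card F)}"
    (is "_ \<le> real (card ?B)")
proof -
  let ?W = "rest n P"
  have P: "spine n w E P" and FW: "F \<subseteq> ?W \<times> ?W" and FE: "\<And>u z. (u, z) \<in> F \<Longrightarrow> u \<noteq> z \<and> {u, z} \<in> E"
    and deg: "\<forall>u\<in>?W. card (F `` {u}) \<le> 20" and pot: "potential ?W F < 1"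
    using ch by (auto simp: choices_def)
  have w1: "1 \<le> w" using w by simp
  note rest = card_rest[OF P w1 w(2)]
  have finF: "finite F" by (rule finite_choices[OF ch])
  define U where "U = {u \<in> ?W. card (F `` {u}) < 20}"
  define V where "V u = {z \<in> ?W. z \<noteq> u \<and> (u, z) \<notin> F \<and> potential ?W (insert (u, z) F) \<le> potential ?W F}" for u
  define X where "X = Sigma U V"
  have finU: "finite U" by (simp add: U_def)
  have finV: "finite (V u)" for u by (simp add: V_def)
  have "F \<inter> ?W \<times> UNIV = F" using FW by blast
  then have cF: "card F = (\<Sum>u\<in>?W. card (F `` {u}))" using card_choices[OF finF, of ?W] by simp
  have "20 * w = (\<Sum>u\<in>?W. 20)" using rest by simp
  also have "\<dots> \<le> (\<Sum>u\<in>?W. card (F `` {u}) + (if u \<in> U then 20 else 0))"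
    by (rule sum_mono) (auto simp: U_def)
  also have "\<dots> = card F + 20 * card U"
    unfolding cF by (simp add: sum.distrib sum.If_cases U_def Int_def)
  finally have cU: "20 * w - card F \<le> 20 * card U" by simp
  have cV: "real w / 4 \<le> card (V u)" if u: "u \<in> U" for u
  proof -
    let ?G = "{z \<in> ?W. (u, z) \<notin> F \<longrightarrow> potential ?W (insert (u, z) F) \<le> potential ?W F}"
    have du: "card (F `` {u}) < 20" using u by (simp add: U_def)
    have "card ?W \<le> 2 * card ?G" by (rule card_good_choices[OF finF deg du]) simp
    then have "w \<le> 2 * card ?G" using rest by simp
    moreover have "?G \<subseteq> V u \<union> insert u (F `` {u})" by (auto simp: V_def)
    then have "card ?G \<le> card (V u \<union> insert u (F `` {u}))"
      using finV finF by (intro card_mono) (auto intro: finite_Image)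
    moreover have "card (V u \<union> insert u (F `` {u})) \<le> card (V u) + card (insert u (F `` {u}))"
      by (rule card_Un_le)
    moreover have "card (insert u (F `` {u})) \<le> Suc (card (F `` {u}))"
      by (rule card_insert_le_m1) simp_all
    ultimately show ?thesis using w du by linarith
  qed
  have "real (card U) * (real w / 4) = (\<Sum>u\<in>U. real w / 4)" by simp
  also have "\<dots> \<le> (\<Sum>u\<in>U. real (card (V u)))" using cV by (intro sum_mono) auto
  also have "\<dots> = card X" unfolding X_def using finU finV by (simp add: card_SigmaI)
  finally have cX: "real (card U) * (real w / 4) \<le> card X" .
  have "(\<lambda>(u, v). {u, v}) ` X \<subseteq> ?B"
  proof clarify
    fix u z assume "(u, z) \<in> X"
    then have u: "u \<in> ?W" "card (F `` {u}) < 20"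
      and z: "z \<in> ?W" "z \<noteq> u" "(u, z) \<notin> F" "potential ?W (insert (u, z) F) \<le> potential ?W F"
      by (auto simp: X_def U_def V_def)
    have "{u, z} \<in> all_edges n" using u z rest by (auto simp: all_edges_def card_insert_if)
    moreover have "choices n w (insert {u, z} E) P (insert (u, z) F)"
    proof -
      have "card (insert (u, z) F `` {x}) \<le> 20" if "x \<in> ?W" for x
      proof (cases "x = u")
        case True
        then have "insert (u, z) F `` {x} = insert z (F `` {u})" by auto
        moreover have "card (insert z (F `` {u})) \<le> 20"
          using u(2) by (intro card_insert_le_m1) auto
        ultimately show ?thesis by simp
      next
        case False
        then have "insert (u, z) F `` {x} = F `` {x}" by auto
        then show ?thesis using deg that by simp
      qed
      moreover have "spine n w (insert {u, z} E) P"
        using P is_path_mono[of E P "insert {u, z} E"] by (auto simp: spine_def)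
      ultimately show ?thesis
        using u z FW FE pot unfolding choices_def by auto
    qed
    moreover have "card (insert (u, z) F) = Suc (card F)" using z finF by simp
    ultimately show "{u, z} \<in> all_edges n \<and>
        (\<exists>P F'. choices n w (insert {u, z} E) P F' \<and> card F' = Suc (card F))" by blast
  qed
  then have "card ((\<lambda>(u, v). {u, v}) ` X) \<le> card ?B"
    by (intro card_mono) (auto simp: finite_all_edges)
  moreover have "card X \<le> 2 * card ((\<lambda>(u, v). {u, v}) ` X)"
    unfolding X_def using finU finV by (intro card_le_twice_card_unordered finite_SigmaI) auto
  ultimately have "real (card X) \<le> 2 * real (card ?B)" by linarith
  moreover have "real (20 * w - card F) * w \<le> real (20 * card U) * w"
    using cU by (intro mult_right_mono of_nat_mono) auto
  ultimately show ?thesis using cX by simp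
qed

lemma route_expander:
  assumes w: "80 \<le> w" "w \<le> n"
  shows "route n (\<lambda>E. \<exists>P. spine n w E P) (expander_spine n w) (20 * w)
    (160 / w * (1 + ln (20 * real w)))"
proof -
  define R where "R i E \<longleftrightarrow> (\<exists>P F. choices n w E P F \<and> card F = i)" for i E
  have w1: "1 \<le> w" using w by simp
  show ?thesis
  proof (rule routeI[where R = R and g = "\<lambda>i. real (20 * w - i) * w / 160"])
    show "R 0 E" if "\<exists>P. spine n w E P" for E
    proof -
      obtain P where "spine n w E P" using \<open>\<exists>P. spine n w E P\<close> by blast
      then have "choices n w E P {}" by (simp add: choices_def potential_empty)
      then show ?thesis unfolding R_def by force
    qed
    show "expander_spine n w E" if "R (20 * w) E" for E
      using that expander_spine_of_choices w1 w(2) unfolding R_def by blast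
    show "R i E'" if "E \<subseteq> E'" "R i E" for i E E'
      using that choices_mono unfolding R_def by blast
    show "0 < real (20 * w - i) * w / 160" if "i < 20 * w" for i using that w by simp
    show "real (20 * w - i) * w / 160 \<le> card {e \<in> all_edges n. R (Suc i) (insert e E)}"
      if R: "R i E" for i E
    proof -
      obtain P F where "choices n w E P F" "card F = i" using R unfolding R_def by blast
      then show ?thesis using card_choice_boosters[OF w, of E P F] unfolding R_def by simp
    qed
    have "(\<Sum>i<20 * w. 1 / (real (20 * w - i) * w / 160)) = 160 / w * (\<Sum>i<20 * w. 1 / real (20 * w - i))"
      unfolding sum_distrib_left by (rule sum.cong) auto
    also have "\<dots> \<le> 160 / w * (1 + ln (real (20 * w)))"
      using w by (intro mult_left_mono sum_inverse_rev_le_ln) auto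
    finally show "(\<Sum>i<20 * w. 1 / (real (20 * w - i) * w / 160)) \<le> 160 / w * (1 + ln (20 * real w))"
      by simp
  qed
qed

section \<open>Hamilton cycles\<close>

lemma n_le_card_if_hamiltonian:
  assumes "hamiltonian n E" "finite E"
  shows "n \<le> card E"
proof -
  obtain vs where n: "3 \<le> n" and vs: "length vs = n" "distinct vs"
    and E: "\<And>i. i < n \<Longrightarrow> {vs ! i, vs ! (Suc i mod n)} \<in> E"
    using assms(1) by (auto simp: hamiltonian_def is_hamilton_cycle_def)
  let ?f = "\<lambda>i. {vs ! i, vs ! (Suc i mod n)}"
  have "inj_on ?f {..<n}"
  proof (rule inj_onI)
    fix i j assume ij: "i \<in> {..<n}" "j \<in> {..<n}" "?f i = ?f j"
    have eq: "vs ! x = vs ! y \<longleftrightarrow> x = y" if "x < n" "y < n" for x y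
      using that vs by (simp add: nth_eq_iff_index_eq)
    have S: "Suc x mod n = (if Suc x = n then 0 else Suc x)" if "x < n" for x using that by simp
    \<comment> \<open>Two positions on the cycle can give the same edge only if each follows the
      other, which \<open>3 \<le> n\<close> excludes.\<close>
    have "i = j \<or> (i = Suc j mod n \<and> Suc i mod n = j)"
      using ij(3) ij(1,2) n by (auto simp: doubleton_eq_iff eq)
    then show "i = j" using ij(1,2) n S[of i] S[of j] by (auto split: if_splits)
  qed
  then have "card (?f ` {..<n}) = n" by (simp add: card_image)
  moreover have "card (?f ` {..<n}) \<le> card E" using E assms(2) by (intro card_mono) auto
  ultimately show ?thesis by simp
qed

text \<open>A round adds at most one edge, and a Hamilton cycle has \<open>n\<close> of
  them.\<close>

lemma not_hamiltonian_early:
  assumes "online_algorithm B" "t < n" "h \<in> set_pmf (achlioptas n K B t)"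
  shows "\<not> hamiltonian n (graph_of h)"
proof
  assume ham: "hamiltonian n (graph_of h)"
  have sub: "graph_of h \<subseteq> snd ` set h" by (force simp: graph_of_def)
  then have "finite (graph_of h)" by (rule finite_subset) simp
  with ham have "n \<le> card (graph_of h)" by (rule n_le_card_if_hamiltonian)
  also have "\<dots> \<le> card (snd ` set h)" using sub by (intro card_mono) auto
  also have "\<dots> \<le> length h" by (meson card_image_le card_length finite_set order_trans)
  finally show False using set_pmf_achlioptas[OF assms(1,3)] assms(2) by simp
qed

text \<open>The steps are \<open>n - 1\<close> joins, \<open>20 * w\<close> choices,
  \<open>w - 1\<close> extensions and one closing edge.\<close>

lemma route_hamiltonian:
  assumes a: "a > 0" and w: "80 \<le> w" "w < n" "1 + 2 * a * (1 + ln n) \<le> w"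
  shows "route n (\<lambda>E. True) (hamiltonian n) (n + 21 * w - 1)
    (16 / a + 160 / w * (1 + ln (20 * real w)) + 12 / w * (1 + ln w) + 12 / w)"
proof -
  have "route n (\<lambda>E. True) (hamiltonian n) (n - 1 + 20 * w + (w - 1) + 1)
    (16 / a + 160 / w * (1 + ln (20 * real w)) + 12 / w * (1 + ln w) + 12 / w)"
    using assms by (intro route_trans[OF route_trans[OF route_trans[OF route_spine route_expander]
          route_hamilton_path] route_close]) auto
  moreover have "n - 1 + 20 * w + (w - 1) + 1 = n + 21 * w - 1" using w by simp
  ultimately show ?thesis by (simp only:)
qed

text \<open>With about \<open>\<beta> * n\<close> vertices left for the expander, the total cost is
  of order \<open>ln n / (\<beta> * n)\<close>, hence at most of order
  \<open>K * \<beta> / n\<close>. A slack of \<open>sqrt \<beta> * n\<close> rounds then fails with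
  probability of order \<open>sqrt \<beta>\<close>.\<close>

lemma hamilton_algorithm:
  fixes \<beta> :: real
  assumes n: "20 \<le> n" and K: "0 < K" and \<beta>: "0 < \<beta>" "80 \<le> \<beta> * n" "\<beta> * n + 1 < n"
    and ln: "ln n \<le> K * \<beta>\<^sup>2"
  shows "\<exists>A. online_algorithm A \<and>
    measure_pmf.prob (achlioptas n K A (n + 21 * nat \<lceil>\<beta> * n\<rceil> - 1 + nat \<lceil>sqrt \<beta> * n\<rceil>))
      {h. hamiltonian n (graph_of h)} \<ge> 1 - 322 * sqrt \<beta>"
proof -
  define L where "L = ln (real n)"
  \<comment> \<open>Joining may then give up \<open>\<beta> * n / 2\<close> vertices, and the other
    half of \<open>\<beta> * n\<close> covers the additional 1 required of \<open>w\<close>.\<close>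
  define a where "a = \<beta> * n / (4 * (1 + L))"
  define w where "w = nat \<lceil>\<beta> * n\<rceil>"
  define D where "D = nat \<lceil>sqrt \<beta> * n\<rceil>"
  define c where "c = 16 / a + 160 / w * (1 + ln (20 * real w)) + 12 / w * (1 + ln w) + 12 / w"
  have "exp 1 \<le> real n" using exp_le n by linarith
  then have L: "1 \<le> L" unfolding L_def using n by (subst ln_ge_iff) auto
  have \<beta>n: "0 < \<beta> * n" using \<beta> n by simp
  have a: "a > 0" unfolding a_def using \<beta>n L by simp
  have w: "\<beta> * n \<le> w" "real w < \<beta> * n + 1" unfolding w_def using \<beta>n by linarith+
  then have w': "80 \<le> w" "w < n" using \<beta> by linarith+
  have D: "sqrt \<beta> * n \<le> D" unfolding D_def by linarith
  have D0: "D > 0" using D \<beta> n by (smt (verit) mult_pos_pos of_nat_0_less_iff of_nat_0_le_iff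
        real_sqrt_gt_0_iff numeral_less_real_of_nat_iff of_nat_le_iff)
  have "2 * a * (1 + ln n) = \<beta> * n / 2" unfolding a_def L_def[symmetric] using L by (simp add: field_simps)
  then have "1 + 2 * a * (1 + ln n) \<le> w" using w \<beta> by linarith
  from route_algorithm[OF route_hamiltonian[OF a w' this] TrueI K D0] obtain A where
    A: "online_algorithm A" "measure_pmf.prob (achlioptas n K A (n + 21 * w - 1 + D))
      {h. hamiltonian n (graph_of h)} \<ge> 1 - real n ^ 2 * c / (2 * K * D)"
    unfolding c_def by auto
  have lnw: "ln (real w) \<le> L" unfolding L_def using w' by simp
  have "20 * real w \<le> real n * real n" using w' n by (intro mult_mono) auto
  then have "ln (20 * real w) \<le> ln (real n * real n)" using w' by simp
  also have "\<dots> = 2 * L" unfolding L_def using n by (simp add: ln_mult)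
  finally have ln20w: "ln (20 * real w) \<le> 2 * L" .
  have inv: "x / w * y \<le> x * z / (\<beta> * n)" if "0 \<le> x" "y \<le> z" "0 \<le> z" for x y z :: real
  proof -
    have "x / w * y \<le> x / w * z" using that by (intro mult_left_mono) auto
    also have "\<dots> \<le> x / (\<beta> * n) * z" using that w \<beta>n by (intro mult_right_mono divide_left_mono) auto
    finally show ?thesis by simp
  qed
  have "16 / a = 64 * (1 + L) / (\<beta> * n)" unfolding a_def by simp
  also have "\<dots> \<le> 128 * L / (\<beta> * n)" using L \<beta>n by (intro divide_right_mono) auto
  finally have "16 / a \<le> 128 * L / (\<beta> * n)" .
  moreover have "160 / w * (1 + ln (20 * real w)) \<le> 160 * (3 * L) / (\<beta> * n)"
    using ln20w L by (intro inv) auto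
  moreover have "12 / w * (1 + ln w) \<le> 12 * (2 * L) / (\<beta> * n)"
    using lnw L by (intro inv) auto
  moreover have "12 / w * 1 \<le> 12 * L / (\<beta> * n)" using L by (intro inv) auto
  ultimately have "c \<le> 128 * L / (\<beta> * n) + 160 * (3 * L) / (\<beta> * n) + 12 * (2 * L) / (\<beta> * n) + 12 * L / (\<beta> * n)"
    unfolding c_def by linarith
  also have "\<dots> = 644 * L / (\<beta> * n)" by (simp add: add_divide_distrib[symmetric])
  also have "\<dots> \<le> 644 * (K * \<beta>\<^sup>2) / (\<beta> * n)"
    using ln \<beta>n unfolding L_def by (intro divide_right_mono mult_left_mono) auto
  also have "\<dots> = 644 * K * \<beta> / n" using \<beta> by (simp add: power2_eq_square)
  finally have c: "c \<le> 644 * K * \<beta> / n" .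
  have "real n ^ 2 * c / (2 * K * D) \<le> real n ^ 2 * (644 * K * \<beta> / n) / (2 * K * D)"
    using c K by (intro divide_right_mono mult_left_mono) auto
  also have "\<dots> = 322 * (\<beta> * n) / D" using K n by (simp add: power2_eq_square)
  also have "\<dots> \<le> 322 * (\<beta> * n) / (sqrt \<beta> * n)"
    using D \<beta> n \<beta>n D0 by (intro divide_left_mono) auto
  also have "\<dots> = 322 * (\<beta> / sqrt \<beta>)" using n by simp
  also have "\<beta> / sqrt \<beta> = sqrt \<beta>" using \<beta> by (simp add: real_div_sqrt)
  finally have "1 - 322 * sqrt \<beta> \<le> measure_pmf.prob (achlioptas n K A (n + 21 * w - 1 + D))
      {h. hamiltonian n (graph_of h)}" using A(2) by linarith
  then show ?thesis using A(1) unfolding w_def D_def by blast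
qed

theorem theorem1p2:
  fixes K :: "nat \<Rightarrow> nat"
  assumes "(\<lambda>n. real (K n)) \<in> \<omega>(\<lambda>n. ln (real n))"
  shows "(\<exists>(A :: nat \<Rightarrow> algorithm) (T :: nat \<Rightarrow> nat).
            (\<forall>n. online_algorithm (A n)) \<and>
            (\<lambda>n. real (T n) - real n) \<in> o(\<lambda>n. real n) \<and>
            (\<lambda>n. measure_pmf.prob (achlioptas n (K n) (A n) (T n)) {h. hamiltonian n (graph_of h)})
              \<longlonglongrightarrow> 1) \<and>
         (\<forall>n (B :: algorithm) t. online_algorithm B \<longrightarrow> t < n \<longrightarrow>
            (\<forall>h \<in> set_pmf (achlioptas n (K n) B t). \<not> hamiltonian n (graph_of h)))"
proof (intro conjI)
  show "\<forall>n (B :: algorithm) t. online_algorithm B \<longrightarrow> t < n \<longrightarrow>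
      (\<forall>h \<in> set_pmf (achlioptas n (K n) B t). \<not> hamiltonian n (graph_of h))"
    using not_hamiltonian_early by blast
  \<comment> \<open>The first summand ensures \<open>ln n \<le> K * \<beta>^2\<close>, the second
    \<open>\<beta> * n \<ge> sqrt n\<close>, which is at least 80 from \<open>n = 6400\<close> on.
    Both tend to 0, the first by the growth of \<open>K\<close>.\<close>
  define \<beta> where "\<beta> n = sqrt (ln (real n) / K n) + 1 / sqrt n" for n
  define T where "T n = n + 21 * nat \<lceil>\<beta> n * n\<rceil> - 1 + nat \<lceil>sqrt (\<beta> n) * n\<rceil>" for n
  let ?p = "\<lambda>n A. measure_pmf.prob (achlioptas n (K n) A (T n)) {h. hamiltonian n (graph_of h)}"
  have "(\<lambda>n. ln (real n)) \<in> o(\<lambda>n. real (K n))"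
    using assms by (simp add: smallomega_iff_smallo)
  then have "(\<lambda>n. ln (real n) / real (K n)) \<longlonglongrightarrow> 0" by (rule smalloD_tendsto)
  then have "(\<lambda>n. sqrt (ln (real n) / real (K n))) \<longlonglongrightarrow> 0"
    using tendsto_real_sqrt by fastforce
  moreover have "(\<lambda>n. 1 / sqrt (real n)) \<longlonglongrightarrow> 0" by (rule tendsto_divide_0[OF tendsto_const]) (rule filterlim_compose[OF filterlim_at_top_imp_at_infinity[OF sqrt_at_top] filterlim_real_sequentially])
  ultimately have \<beta>_lim: "\<beta> \<longlonglongrightarrow> 0" unfolding \<beta>_def using tendsto_add by fastforce
  then have sqrt_lim: "(\<lambda>n. sqrt (\<beta> n)) \<longlonglongrightarrow> 0" using tendsto_real_sqrt by fastforce
  have K: "eventually (\<lambda>n. 1 * norm (ln (real n)) \<le> norm (real (K n))) sequentially"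
    using landau_omega.smallD[OF assms, of 1] by simp
  have big: "eventually (\<lambda>n. n \<ge> (6400::nat)) sequentially" by (rule eventually_ge_at_top)
  have small: "eventually (\<lambda>n. \<beta> n < 1 / 2) sequentially"
    using \<beta>_lim by (rule order_tendstoD) simp
  have good: "eventually (\<lambda>n. 0 < \<beta> n \<and> 80 \<le> \<beta> n * n \<and> 
      (\<exists>A. online_algorithm A \<and> 1 - 322 * sqrt (\<beta> n) \<le> ?p n A)) sequentially"
    using K big small
  proof eventually_elim
    case (elim n)
    have n: "real n \<ge> 6400" using elim(2) by simp
    then have "ln (real n) > 0" by simp
    then have K0: "K n > 0" using elim(1) by (cases "K n = 0") auto
    have s: "sqrt (ln (real n) / K n) \<ge> 0" using \<open>ln (real n) > 0\<close> by simp
    have "80 \<le> sqrt (real n)" using n by (intro real_le_rsqrt) simp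
    also have "\<dots> = 1 / sqrt n * n" by (simp add: real_div_sqrt)
    also have "\<dots> \<le> \<beta> n * n" unfolding \<beta>_def using s by (intro mult_right_mono) auto
    finally have 80: "80 \<le> \<beta> n * n" .
    have pos: "0 < \<beta> n" unfolding \<beta>_def using s n by (intro add_nonneg_pos) auto
    have "ln (real n) / K n = (sqrt (ln (real n) / K n))\<^sup>2" using \<open>ln (real n) > 0\<close> by simp
    also have "\<dots> \<le> (\<beta> n)\<^sup>2" using s unfolding \<beta>_def by (intro power_mono) auto
    finally have ln: "ln (real n) \<le> K n * (\<beta> n)\<^sup>2" using K0 by (simp add: field_simps)
    have "\<beta> n * n \<le> 1 / 2 * n" using elim(3) by (intro mult_right_mono) auto
    then have less: "\<beta> n * n + 1 < n" using n by linarith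
    have n20: "20 \<le> n" using elim(2) by simp
    show ?case using hamilton_algorithm[OF n20 K0 pos 80 less ln] pos 80 unfolding T_def by blast
  qed
  have "\<exists>A. online_algorithm A \<and>
      ((\<exists>A. online_algorithm A \<and> 1 - 322 * sqrt (\<beta> n) \<le> ?p n A) \<longrightarrow> 1 - 322 * sqrt (\<beta> n) \<le> ?p n A)" for n
  proof (cases "\<exists>A. online_algorithm A \<and> 1 - 322 * sqrt (\<beta> n) \<le> ?p n A")
    case False
    have "online_algorithm (\<lambda>h S. SOME e. e \<in> S)" by (auto simp: online_algorithm_def some_in_eq)
    with False show ?thesis by blast
  qed blast
  then obtain A where A: "\<And>n. online_algorithm (A n)"
    and Ap: "\<And>n. \<exists>A. online_algorithm A \<and> 1 - 322 * sqrt (\<beta> n) \<le> ?p n A \<Longrightarrow> 1 - 322 * sqrt (\<beta> n) \<le> ?p n (A n)"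
    by metis
  have "(\<lambda>n. ?p n (A n)) \<longlonglongrightarrow> 1"
  proof (rule tendsto_sandwich)
    show "eventually (\<lambda>n. 1 - 322 * sqrt (\<beta> n) \<le> ?p n (A n)) sequentially"
      using good by eventually_elim (use Ap in blast)
    show "eventually (\<lambda>n. ?p n (A n) \<le> 1) sequentially" by simp
    have "(\<lambda>n. 1 - 322 * sqrt (\<beta> n)) \<longlonglongrightarrow> 1 - 322 * 0"
      by (intro tendsto_intros sqrt_lim)
    then show "(\<lambda>n. 1 - 322 * sqrt (\<beta> n)) \<longlonglongrightarrow> 1" by simp
  qed simp
  moreover have "(\<lambda>n. real (T n) - real n) \<in> o(\<lambda>n. real n)"
  proof (rule smalloI_tendsto)
    show "(\<lambda>n. (real (T n) - real n) / real n) \<longlonglongrightarrow> 0"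
    proof (rule tendsto_sandwich)
      have "eventually (\<lambda>n. 0 \<le> (real (T n) - real n) / real n \<and>
          (real (T n) - real n) / real n \<le> 21 * \<beta> n + sqrt (\<beta> n) + 22 * (1 / real n)) sequentially"
        using good big
      proof eventually_elim
        case (elim n)
        define x y where "x = nat \<lceil>\<beta> n * n\<rceil>" and "y = nat \<lceil>sqrt (\<beta> n) * n\<rceil>"
        have x: "80 \<le> real x" "real x \<le> \<beta> n * n + 1" using elim unfolding x_def by linarith+
        have "0 \<le> sqrt (\<beta> n) * n" using elim by simp
        then have y: "real y \<le> sqrt (\<beta> n) * n + 1" unfolding y_def by linarith
        \<comment> \<open>As \<open>x\<close> is positive, the subtraction of 1 in \<open>T\<close>
          is not truncated.\<close>
        have "T n + 1 = n + 21 * x + y" using x unfolding T_def x_def[symmetric] y_def[symmetric] by simp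
        then have T: "real (T n) - real n = 21 * real x + real y - 1" by linarith
        have n0: "real n > 0" using elim by simp
        have "real (T n) - real n \<le> (21 * \<beta> n + sqrt (\<beta> n)) * n + 22"
          unfolding T using x y by (simp add: algebra_simps)
        then have "(real (T n) - real n) / real n \<le> ((21 * \<beta> n + sqrt (\<beta> n)) * n + 22) / n"
          using n0 by (intro divide_right_mono) auto
        also have "\<dots> = 21 * \<beta> n + sqrt (\<beta> n) + 22 * (1 / real n)" using n0 by (simp add: add_divide_distrib)
        finally show ?case using T x n0 by simp
      qed
      then show "eventually (\<lambda>n. 0 \<le> (real (T n) - real n) / real n) sequentially"
        "eventually (\<lambda>n. (real (T n) - real n) / real n \<le> 21 * \<beta> n + sqrt (\<beta> n) + 22 * (1 / real n)) sequentially"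
        by (auto elim: eventually_mono)
      have "(\<lambda>n. 21 * \<beta> n + sqrt (\<beta> n) + 22 * (1 / real n)) \<longlonglongrightarrow> 21 * 0 + 0 + 22 * 0"
        by (intro tendsto_intros \<beta>_lim sqrt_lim lim_1_over_n)
      then show "(\<lambda>n. 21 * \<beta> n + sqrt (\<beta> n) + 22 * (1 / real n)) \<longlonglongrightarrow> 0" by simp
    qed simp
    show "eventually (\<lambda>n. real n \<noteq> 0) sequentially"
      using big by eventually_elim simp
  qed
  ultimately show "\<exists>(A :: nat \<Rightarrow> algorithm) (T :: nat \<Rightarrow> nat).
      (\<forall>n. online_algorithm (A n)) \<and> (\<lambda>n. real (T n) - real n) \<in> o(\<lambda>n. real n) \<and>
      (\<lambda>n. measure_pmf.prob (achlioptas n (K n) (A n) (T n)) {h. hamiltonian n (graph_of h)}) \<longlonglongrightarrow> 1"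
    using A by blast
qed

end
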